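(* Let $D$ be a discrete space of cardinality $|D|=\mathrm{non}(\mathcal M)$ and let $\alpha D=\{\infty\}\cup D$ be its one-point compactification. Then the closed interval $[0,1]$ and the space $\alpha D$ are hereditarily supercompact, but their product $[0,1]\times\alpha D$ is not hereditarily supercompact.
   Context: A topological space $X$ is supercompact if it has a subbase $\mathcal B$ of its topology such that each cover of $X$ by elements of $\mathcal B$ has a subcover consisting of at most two elements. A space is hereditarily supercompact if each of its closed subspaces is supercompact. For a discrete space $D$, $\alpha D=\{\infty\}\cup D$ (with $\infty\notin D$) is the space in which a set $U$ is open iff $\infty\notin U$ or $\alpha D\setminus U$ is finite. $\mathrm{non}(\mathcal M)$ is the smallest cardinality of a non-meager subset of the real line. *)

theory Defs
  imports "HOL-Analysis.Analysis"
begin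

unbundle cardinal_syntax

section \<open>Supercompact spaces\<close>

text \<open>
  As usual, the empty intersection of members of a subbase is read as the whole space, so a subbase
  is a family of open sets but need not cover the space by itself.
\<close>

definition subbase_of :: "'a topology \<Rightarrow> 'a set set \<Rightarrow> bool" where
  "subbase_of X \<B> \<longleftrightarrow>
     (\<forall>U\<in>\<B>. openin X U) \<and>
     topology (arbitrary union_of
       (finite intersection_of (\<lambda>U. U \<in> \<B>) relative_to topspace X)) = X"

definition supercompact_space :: "'a topology \<Rightarrow> bool" where
  "supercompact_space X \<longleftrightarrow>
     (\<exists>\<B>. subbase_of X \<B> \<and>
        (\<forall>\<C>. \<C> \<subseteq> \<B> \<and> topspace X \<subseteq> \<Union>\<C> \<longrightarrow>
           (\<exists>\<C>'. \<C>' \<subseteq> \<C> \<and> finite \<C>' \<and> card \<C>' \<le> 2 \<and> topspace X \<subseteq> \<Union>\<C>')))"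

definition hereditarily_supercompact_space :: "'a topology \<Rightarrow> bool" where
  "hereditarily_supercompact_space X \<longleftrightarrow>
     (\<forall>S. closedin X S \<longrightarrow> supercompact_space (subtopology X S))"

section \<open>The one-point compactification of a discrete space\<close>

text \<open>The point \<open>d \<in> D\<close> is represented by \<open>Some d\<close>, the point at infinity by \<open>None\<close>.\<close>

definition discrete_compactification :: "'a set \<Rightarrow> 'a option topology" where
  "discrete_compactification D =
     topology (\<lambda>U. U \<subseteq> insert None (Some ` D) \<and>
                   (None \<notin> U \<or> finite (insert None (Some ` D) - U)))"

lemma openin_discrete_compactification:
  "openin (discrete_compactification D) U \<longleftrightarrow>
     U \<subseteq> insert None (Some ` D) \<and> (None \<notin> U \<or> finite (insert None (Some ` D) - U))"
proof -
  let ?A = "insert None (Some ` D)"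
  let ?P = "\<lambda>U. U \<subseteq> ?A \<and> (None \<notin> U \<or> finite (?A - U))"
  have "istopology ?P"
    unfolding istopology_def
  proof (intro conjI allI impI)
    fix S T assume S: "?P S" and T: "?P T"
    show "S \<inter> T \<subseteq> ?A" using S by blast
    have "?A - (S \<inter> T) = (?A - S) \<union> (?A - T)" by blast
    then show "None \<notin> S \<inter> T \<or> finite (?A - S \<inter> T)" using S T by auto
  next
    fix \<K> assume K: "\<forall>K\<in>\<K>. ?P K"
    show "\<Union>\<K> \<subseteq> ?A" using K by blast
    show "None \<notin> \<Union>\<K> \<or> finite (?A - \<Union>\<K>)"
    proof (cases "None \<in> \<Union>\<K>")
      case True
      then obtain K where "K \<in> \<K>" "None \<in> K" by blast
      have "finite (?A - K)" using K \<open>K \<in> \<K>\<close> \<open>None \<in> K\<close> by auto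
      moreover have "?A - \<Union>\<K> \<subseteq> ?A - K" using \<open>K \<in> \<K>\<close> by auto
      ultimately have "finite (?A - \<Union>\<K>)" by (rule rev_finite_subset)
      then show ?thesis ..
    qed simp
  qed
  then show ?thesis
    by (simp add: discrete_compactification_def topology_inverse')
qed

lemma topspace_discrete_compactification [simp]:
  "topspace (discrete_compactification D) = insert None (Some ` D)"
proof (rule antisym)
  show "topspace (discrete_compactification D) \<subseteq> insert None (Some ` D)"
    using openin_topspace[of "discrete_compactification D"]
    unfolding openin_discrete_compactification by (rule conjunct1)
  show "insert None (Some ` D) \<subseteq> topspace (discrete_compactification D)"
    by (rule openin_subset) (simp add: openin_discrete_compactification)
qed

section \<open>The cardinal \<open>non(M)\<close>\<close>

definition nowhere_dense :: "'a::topological_space set \<Rightarrow> bool" where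
  "nowhere_dense S \<longleftrightarrow> interior (closure S) = {}"

definition meager :: "'a::topological_space set \<Rightarrow> bool" where
  "meager S \<longleftrightarrow> (\<exists>\<F>. countable \<F> \<and> (\<forall>N\<in>\<F>. nowhere_dense N) \<and> S = \<Union>\<F>)"

text \<open>
  The cardinality of a non-meager set of reals of least cardinality. The lemmas \<open>non_meager_card_attained\<close>
  and \<open>non_meager_card_least\<close> below show that the choice is well defined up to \<open>=o\<close>.
\<close>

definition non_meager_card :: "real rel" where
  "non_meager_card = |SOME N :: real set. \<not> meager N \<and> (\<forall>N' :: real set. \<not> meager N' \<longrightarrow> |N| \<le>o |N'| )|"

lemma not_meager_UNIV_real: "\<not> meager (UNIV :: real set)"
proof
  assume "meager (UNIV :: real set)"
  then obtain \<F> where F: "countable \<F>" "\<And>N. N \<in> \<F> \<Longrightarrow> nowhere_dense N" "(UNIV :: real set) = \<Union>\<F>"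
    unfolding meager_def by blast
  let ?G = "(\<lambda>N. - closure N) ` \<F>"
  have "UNIV \<subseteq> closure (\<Inter>?G)"
  proof (rule Baire)
    show "closed (UNIV :: real set)" "countable ?G" using F(1) by auto
    fix T assume "T \<in> ?G"
    then obtain N where "N \<in> \<F>" "T = - closure N" by blast
    then show "openin (top_of_set UNIV) T \<and> UNIV \<subseteq> closure T"
      using F(2)[of N] by (simp add: nowhere_dense_def closure_complement open_Compl flip: open_openin)
  qed
  moreover have "x \<notin> \<Inter>?G" for x
  proof -
    obtain N where "N \<in> \<F>" "x \<in> N" using F(3) by blast
    then show ?thesis using closure_subset by blast
  qed
  then have "\<Inter>?G = {}" by blast
  ultimately show False by simp
qed

lemma non_meager_card_chosen:
  "\<exists>N :: real set. \<not> meager N \<and> (\<forall>N' :: real set. \<not> meager N' \<longrightarrow> |N| \<le>o |N'| ) \<and> non_meager_card = |N|"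
proof -
  let ?R = "{|N| | N :: real set. \<not> meager N}"
  have "\<exists>r\<in>?R. \<forall>r'\<in>?R. r \<le>o r'"
    by (rule exists_minim_Card_order) (use not_meager_UNIV_real card_of_Card_order in blast)+
  then have "\<exists>N :: real set. \<not> meager N \<and> (\<forall>N' :: real set. \<not> meager N' \<longrightarrow> |N| \<le>o |N'| )"
    by blast
  from someI_ex[OF this] show ?thesis
    unfolding non_meager_card_def by blast
qed

lemma non_meager_card_attained: "\<exists>N :: real set. \<not> meager N \<and> |N| =o non_meager_card"
  using non_meager_card_chosen card_of_refl by metis

lemma non_meager_card_least: "\<not> meager N \<Longrightarrow> non_meager_card \<le>o |N|" for N :: "real set"
  using non_meager_card_chosen by metis

end

theory Submission
  imports Defs
begin

text \<open>
  A supercompact compact space has a family \<open>\<A>\<close> of closed sets (intersections of complements of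
  subbasic sets) in which pairwise intersecting triples have a common point, and such that finite unions
  of members of \<open>\<A>\<close> separate closed sets from the complements of their open neighbourhoods.

  A real number \<open>x\<close> codes a closed set \<open>F x \<subseteq> [0,1]\<close>, the branches of a binary tree pruned by the digits
  of \<open>x\<close>, in such a way that a finite part of the digits leaves \<open>F x\<close> free to approximate any finite set inside
  a suitable interval. Indexing \<open>D\<close> by a non-meager set of reals, consider the closed subspace
  \<open>[0,1] \<times> {\<infinity>}\<close> together with the fibres \<open>F x \<times> {d}\<close>. Each fibre is clopen, so
  a relatively open piece of it lies in a member \<open>A \<in> \<A>\<close> contained in the fibre; by non-meagerness, the
  same interval serves for a set of \<open>d\<close> that is locally uncountable, and finite approximations
  of the fibre can be prescribed there. A closed set meets all but countably many fibres only below its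
  trace on \<open>[0,1] \<times> {\<infinity>}\<close>. Choosing the fibre to avoid the intersection of the traces of two
  intersecting members \<open>G, H \<in> \<A>\<close> while \<open>A\<close> meets both contradicts the intersection property of \<open>\<A>\<close>.
\<close>

section \<open>Subbases and supercompact spaces\<close>

lemma subbase_ofI:
  assumes "\<And>B. B \<in> \<B> \<Longrightarrow> openin X B"
    and "\<And>U x. openin X U \<Longrightarrow> x \<in> U \<Longrightarrow>
      \<exists>\<U>. finite \<U> \<and> \<U> \<subseteq> \<B> \<and> x \<in> \<Inter>\<U> \<and> topspace X \<inter> \<Inter>\<U> \<subseteq> U"
  shows "subbase_of X \<B>"
proof -
  have "openin X S" if "(finite intersection_of (\<lambda>U. U \<in> \<B>) relative_to topspace X) S"
    (is ?S) for S
  proof -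
    obtain \<U> where "finite \<U>" "\<U> \<subseteq> \<B>" "S = topspace X \<inter> \<Inter>\<U>"
      using \<open>?S\<close> by (auto simp: relative_to_def intersection_of_def)
    then show ?thesis using assms(1) by (auto intro: openin_Int_Inter)
  qed
  moreover have "\<exists>B. (finite intersection_of (\<lambda>U. U \<in> \<B>) relative_to topspace X) B \<and> x \<in> B \<and> B \<subseteq> U"
    if "openin X U" "x \<in> U" for U x
  proof -
    from assms(2)[OF that] obtain \<U> where
      "finite \<U>" "\<U> \<subseteq> \<B>" "x \<in> \<Inter>\<U>" "topspace X \<inter> \<Inter>\<U> \<subseteq> U"
      by blast
    moreover from this have "(finite intersection_of (\<lambda>U. U \<in> \<B>)) (\<Inter>\<U>)"
      unfolding intersection_of_def by auto
    moreover have "x \<in> topspace X" using that openin_subset by blast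
    ultimately show ?thesis
      by (intro exI[of _ "topspace X \<inter> \<Inter>\<U>"] conjI relative_to_inc) simp_all
  qed
  ultimately have "topology (arbitrary union_of
       (finite intersection_of (\<lambda>U. U \<in> \<B>) relative_to topspace X)) = X"
    by (rule topology_base_unique)
  then show ?thesis using assms(1) by (simp add: subbase_of_def)
qed

lemma subbase_ofE:
  assumes "subbase_of X \<B>" "openin X U" "x \<in> U"
  obtains \<U> where "finite \<U>" "\<U> \<subseteq> \<B>" "x \<in> \<Inter>\<U>" "topspace X \<inter> \<Inter>\<U> \<subseteq> U"
proof -
  have "openin (topology (arbitrary union_of
       (finite intersection_of (\<lambda>U. U \<in> \<B>) relative_to topspace X))) U"
    using assms unfolding subbase_of_def by simp
  then obtain \<V> where "\<V> \<subseteq> Collect (finite intersection_of (\<lambda>U. U \<in> \<B>) relative_to topspace X)"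
    "U = \<Union>\<V>"
    unfolding openin_subbase by (auto simp: union_of_def arbitrary_def)
  then obtain V where "(finite intersection_of (\<lambda>U. U \<in> \<B>) relative_to topspace X) V" "x \<in> V" "V \<subseteq> U"
    using \<open>x \<in> U\<close> by auto
  then show thesis
    using that by (fastforce simp: relative_to_def intersection_of_def)
qed

section \<open>Hereditary supercompactness of the two factors\<close>

lemma supercompact_space_empty: "topspace X = {} \<Longrightarrow> supercompact_space X"
proof -
  assume X: "topspace X = {}"
  then have "subbase_of X {}" using openin_subset by (intro subbase_ofI) fastforce+
  with X show ?thesis unfolding supercompact_space_def
    by (intro exI[of _ "{}"]) simp
qed

text \<open>The union of a nonempty finite chain is one of its members. Rays in one direction form a
  chain, so each direction contributes at most one set to a subcover.\<close>

lemma Union_chain_subset_singleton: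
  assumes "finite \<C>" "\<And>A B. A \<in> \<C> \<Longrightarrow> B \<in> \<C> \<Longrightarrow> A \<subseteq> B \<or> B \<subseteq> A"
  obtains \<C>' where "\<C>' \<subseteq> \<C>" "finite \<C>'" "card \<C>' \<le> 1" "\<Union>\<C> = \<Union>\<C>'"
proof (cases "\<C> = {}")
  case False
  then have "\<Union>\<C> \<in> \<C>"
    using assms by (intro Union_in_chain[where \<A> = UNIV]) (auto simp: subset.chain_def)
  then show ?thesis by (intro that[of "{\<Union>\<C>}"]) auto
qed (use that in force)

text \<open>The open rays in both directions, relative to \<open>S\<close>, form the subbase.
  Compactness makes a cover finite, and then its largest left ray and its largest right ray
  suffice.\<close>

lemma supercompact_space_compact_real:
  fixes S :: "real set"
  assumes "compact S"
  shows "supercompact_space (top_of_set S)"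
proof -
  define \<L> where "\<L> = range (\<lambda>a. S \<inter> {..<a})"
  define \<R> where "\<R> = range (\<lambda>a. S \<inter> {a<..})"
  have op: "openin (top_of_set S) B" if "B \<in> \<L> \<union> \<R>" for B
    using that by (auto simp: \<L>_def \<R>_def intro: openin_open_Int)
  have "subbase_of (top_of_set S) (\<L> \<union> \<R>)"
  proof (rule subbase_ofI[OF op])
    fix U x assume "openin (top_of_set S) U" "x \<in> U"
    then obtain T where "open T" "U = S \<inter> T" by (auto simp: openin_open)
    with \<open>x \<in> U\<close> obtain e where "e > 0" "ball x e \<subseteq> T"
      by (meson IntD2 openE)
    then show "\<exists>\<U>. finite \<U> \<and> \<U> \<subseteq> \<L> \<union> \<R> \<and> x \<in> \<Inter>\<U> \<and> topspace (top_of_set S) \<inter> \<Inter>\<U> \<subseteq> U"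
      using \<open>x \<in> U\<close> \<open>U = S \<inter> T\<close>
      by (intro exI[of _ "{S \<inter> {..<x + e}, S \<inter> {x - e<..}}"])
        (auto simp: \<L>_def \<R>_def dist_real_def ball_def subset_iff)
  qed auto
  moreover have "\<exists>\<C>'. \<C>' \<subseteq> \<C> \<and> finite \<C>' \<and> card \<C>' \<le> 2 \<and> S \<subseteq> \<Union>\<C>'"
    if \<C>: "\<C> \<subseteq> \<L> \<union> \<R>" "S \<subseteq> \<Union>\<C>" for \<C>
  proof -
    have "compact_space (top_of_set S)" using assms by (simp add: compact_space_subtopology)
    then obtain \<F> where \<F>: "finite \<F>" "\<F> \<subseteq> \<C>" "S \<subseteq> \<Union>\<F>"
      using \<C> op unfolding compact_space_alt by (metis subsetD topspace_euclidean_subtopology)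
    obtain \<F>1 where 1: "\<F>1 \<subseteq> \<F> \<inter> \<L>" "finite \<F>1" "card \<F>1 \<le> 1" "\<Union>(\<F> \<inter> \<L>) = \<Union>\<F>1"
      by (rule Union_chain_subset_singleton[of "\<F> \<inter> \<L>"]) (use \<F> in \<open>auto simp: \<L>_def\<close>)
    obtain \<F>2 where 2: "\<F>2 \<subseteq> \<F> \<inter> \<R>" "finite \<F>2" "card \<F>2 \<le> 1" "\<Union>(\<F> \<inter> \<R>) = \<Union>\<F>2"
      by (rule Union_chain_subset_singleton[of "\<F> \<inter> \<R>"]) (use \<F> in \<open>auto simp: \<R>_def\<close>)
    have "S \<subseteq> \<Union>(\<F> \<inter> \<L>) \<union> \<Union>(\<F> \<inter> \<R>)" using \<F> \<C> by blast
    then have "S \<subseteq> \<Union>(\<F>1 \<union> \<F>2)" using 1 2 by simp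
    moreover have "card (\<F>1 \<union> \<F>2) \<le> 2" using card_Un_le[of \<F>1 \<F>2] 1 2 by linarith
    ultimately show ?thesis using 1 2 \<F> by (intro exI[of _ "\<F>1 \<union> \<F>2"]) auto
  qed
  ultimately show ?thesis unfolding supercompact_space_def by auto
qed

lemma hereditarily_supercompact_space_interval:
  "hereditarily_supercompact_space (top_of_set {a..b::real})"
  unfolding hereditarily_supercompact_space_def
proof (intro allI impI)
  fix S assume "closedin (top_of_set {a..b}) S"
  then have "compact S" "{a..b} \<inter> S = S"
    using closedin_compact closedin_imp_subset by blast+
  then show "supercompact_space (subtopology (top_of_set {a..b}) S)"
    by (simp add: subtopology_subtopology supercompact_space_compact_real)
qed

text \<open>The subbase depends on a base point. With base point \<open>\<infinity>\<close> (or any point, if the closed set is a finite set of isolated points), every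
  cover by singletons and complements of singletons avoiding the base point contains two complementary
  members or two different complements.\<close>

lemma hereditarily_supercompact_space_discrete_compactification:
  "hereditarily_supercompact_space (discrete_compactification D)"
  unfolding hereditarily_supercompact_space_def
proof (intro allI impI)
  fix S assume S: "closedin (discrete_compactification D) S"
  define X where "X = subtopology (discrete_compactification D) S"
  have "S \<subseteq> insert None (Some ` D)" using closedin_subset[OF S] by simp
  then have top: "topspace X = S" by (auto simp: X_def)
  show "supercompact_space X"
  proof (cases "S = {}")
    case False
    define p where "p = (if None \<in> S then None else (SOME p. p \<in> S))"
    have "p \<in> S" using False by (auto simp: p_def some_in_eq)
    have "None \<notin> S \<Longrightarrow> finite S"
      using S \<open>S \<subseteq> _\<close> unfolding closedin_def openin_discrete_compactification
      by (simp add: double_diff)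
    then have opX: "openin X U \<longleftrightarrow> U \<subseteq> S \<and> (p \<notin> U \<or> finite (S - U))" for U
    proof (cases "None \<in> S")
      case True
      then have [simp]: "p = None" by (simp add: p_def)
      have "\<exists>T. openin (discrete_compactification D) T \<and> U = T \<inter> S"
        if "U \<subseteq> S" "None \<notin> U \<or> finite (S - U)"
      proof -
        \<comment> \<open>Adding all points outside \<open>S\<close> extends \<open>U\<close> to a
          set that is cofinite whenever \<open>S - U\<close> is finite.\<close>
        let ?T = "U \<union> (insert None (Some ` D) - S)"
        have "insert None (Some ` D) - ?T \<subseteq> S - U" by auto
        then have "openin (discrete_compactification D) ?T"
          using that \<open>S \<subseteq> _\<close> True unfolding openin_discrete_compactification
          by (auto intro: finite_subset)
        moreover have "U = ?T \<inter> S" using that by auto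
        ultimately show ?thesis by blast
      qed
      moreover have "U \<subseteq> S \<and> (None \<notin> U \<or> finite (S - U))"
        if T: "openin (discrete_compactification D) T" "U = T \<inter> S" for T
      proof -
        have "S - U \<subseteq> insert None (Some ` D) - T" using that \<open>S \<subseteq> _\<close> by auto
        then show ?thesis
          using T unfolding openin_discrete_compactification by (blast intro: finite_subset)
      qed
      ultimately have "(\<exists>T. openin (discrete_compactification D) T \<and> U = T \<inter> S) \<longleftrightarrow>
          U \<subseteq> S \<and> (None \<notin> U \<or> finite (S - U))"
        by metis
      then show ?thesis
        unfolding X_def openin_subtopology \<open>p = None\<close> .
    next
      case False
      then have "finite S" using \<open>None \<notin> S \<Longrightarrow> finite S\<close> by blast
      moreover have "openin X U" if "U \<subseteq> S"
      proof -
        have "openin (discrete_compactification D) U"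
          using that False \<open>S \<subseteq> _\<close> unfolding openin_discrete_compactification by auto
        then show ?thesis unfolding X_def openin_subtopology using that by blast
      qed
      ultimately show ?thesis using top openin_subset by blast
    qed
    define \<B> where "\<B> = (\<lambda>d. {d}) ` (S - {p}) \<union> (\<lambda>d. S - {d}) ` (S - {p})"
    have "subbase_of X \<B>"
    proof (rule subbase_ofI)
      show "openin X B" if "B \<in> \<B>" for B
      proof -
        have "S - (S - {d}) \<subseteq> {d}" for d by blast
        then show ?thesis
          using that \<open>p \<in> S\<close> by (auto simp: \<B>_def opX intro: finite_subset)
      qed
      fix U x assume U: "openin X U" "x \<in> U"
      show "\<exists>\<U>. finite \<U> \<and> \<U> \<subseteq> \<B> \<and> x \<in> \<Inter>\<U> \<and> topspace X \<inter> \<Inter>\<U> \<subseteq> U"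
      proof (cases "x = p")
        case True
        then have "finite (S - U)" using U by (simp add: opX)
        then show ?thesis
          using U True opX by (intro exI[of _ "(\<lambda>d. S - {d}) ` (S - U)"]) (auto simp: \<B>_def top)
      next
        case False
        then show ?thesis
          using U opX by (intro exI[of _ "{{x}}"]) (auto simp: \<B>_def)
      qed
    qed
    moreover have "\<exists>\<C>'. \<C>' \<subseteq> \<C> \<and> finite \<C>' \<and> card \<C>' \<le> 2 \<and> S \<subseteq> \<Union>\<C>'"
      if \<C>: "\<C> \<subseteq> \<B>" "S \<subseteq> \<Union>\<C>" for \<C>
    proof -
      \<comment> \<open>Only complements of singletons contain \<open>p\<close> among the members of
        \<open>\<B>\<close>, so the cover has some \<open>S - {d}\<close>; any member containing
        \<open>d\<close> completes it.\<close>
      obtain d where d: "d \<in> S - {p}" "S - {d} \<in> \<C>"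
        using \<C> \<open>p \<in> S\<close> unfolding \<B>_def by blast
      obtain B where B: "B \<in> \<C>" "d \<in> B" using d \<C> by blast
      have "card {S - {d}, B} \<le> 2" by (simp add: card_insert_if)
      then show ?thesis
        using d B by (intro exI[of _ "{S - {d}, B}"]) auto
    qed
    ultimately show ?thesis unfolding supercompact_space_def top by blast
  qed (simp add: supercompact_space_empty top)
qed

text \<open>The members of \<open>\<A>\<close> are the intersections of complements of subbasic
  sets. Two-element subcovers, read through complements, give the triple intersection property;
  compactness and closure of \<open>\<A>\<close> under binary intersections give the finite unions
  between \<open>K\<close> and \<open>U\<close>.\<close>

lemma supercompact_spaceE:
  assumes "supercompact_space X" "compact_space X"
  obtains \<A> where "\<And>A. A \<in> \<A> \<Longrightarrow> closedin X A"
    and "\<And>A B C. A \<in> \<A> \<Longrightarrow> B \<in> \<A> \<Longrightarrow> C \<in> \<A> \<Longrightarrow>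
      A \<inter> B \<noteq> {} \<Longrightarrow> A \<inter> C \<noteq> {} \<Longrightarrow> B \<inter> C \<noteq> {} \<Longrightarrow> A \<inter> B \<inter> C \<noteq> {}"
    and "\<And>K U. closedin X K \<Longrightarrow> openin X U \<Longrightarrow> K \<subseteq> U \<Longrightarrow>
      \<exists>\<G>. finite \<G> \<and> \<G> \<subseteq> \<A> \<and> K \<subseteq> \<Union>\<G> \<and> \<Union>\<G> \<subseteq> U"
proof -
  obtain \<B> where \<B>: "subbase_of X \<B>" and two: "\<And>\<C>. \<C> \<subseteq> \<B> \<Longrightarrow> topspace X \<subseteq> \<Union>\<C> \<Longrightarrow>
      \<exists>\<C>'. \<C>' \<subseteq> \<C> \<and> finite \<C>' \<and> card \<C>' \<le> 2 \<and> topspace X \<subseteq> \<Union>\<C>'"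
    using assms(1) unfolding supercompact_space_def by metis
  define \<A> where "\<A> = {topspace X - \<Union>\<H> |\<H>. \<H> \<subseteq> \<B>}"
  have Int_\<A>: "A \<inter> B \<in> \<A>" if AB: "A \<in> \<A>" "B \<in> \<A>" for A B
  proof -
    from AB obtain \<H>1 \<H>2 where "\<H>1 \<subseteq> \<B>" "\<H>2 \<subseteq> \<B>" "A = topspace X - \<Union>\<H>1" "B = topspace X - \<Union>\<H>2"
      unfolding \<A>_def by blast
    then show ?thesis unfolding \<A>_def
      by (intro CollectI exI[of _ "\<H>1 \<union> \<H>2"]) auto
  qed
  have opB: "openin X B" if "B \<in> \<B>" for B using \<B> that by (simp add: subbase_of_def)
  have closed: "closedin X A" if "A \<in> \<A>" for A
    using that opB unfolding \<A>_def by auto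
  have binary: "A \<inter> B \<inter> C \<noteq> {}"
    if "A \<in> \<A>" "B \<in> \<A>" "C \<in> \<A>" "A \<inter> B \<noteq> {}" "A \<inter> C \<noteq> {}" "B \<inter> C \<noteq> {}" for A B C
  proof
    assume empty: "A \<inter> B \<inter> C = {}"
    from \<open>A \<in> \<A>\<close> \<open>B \<in> \<A>\<close> \<open>C \<in> \<A>\<close> obtain \<H>1 \<H>2 \<H>3
      where H: "\<H>1 \<subseteq> \<B>" "\<H>2 \<subseteq> \<B>" "\<H>3 \<subseteq> \<B>"
        "A = topspace X - \<Union>\<H>1" "B = topspace X - \<Union>\<H>2" "C = topspace X - \<Union>\<H>3"
      unfolding \<A>_def by blast
    have "topspace X \<subseteq> \<Union>(\<H>1 \<union> \<H>2 \<union> \<H>3)" using H empty by auto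
    then obtain \<C> where \<C>: "\<C> \<subseteq> \<H>1 \<union> \<H>2 \<union> \<H>3" "finite \<C>" "card \<C> \<le> 2" "topspace X \<subseteq> \<Union>\<C>"
      using two[of "\<H>1 \<union> \<H>2 \<union> \<H>3"] H by auto
    have "\<C> \<noteq> {}" using \<C> H \<open>A \<inter> B \<noteq> {}\<close> by auto
    then have "card \<C> = 1 \<or> card \<C> = 2" using \<C> card_gt_0_iff[of \<C>] by linarith
    then obtain P Q where PQ: "\<C> = {P, Q}"
      by (metis card_1_singletonE card_2_iff insert_absorb2)
    have "z \<in> A \<and> z \<in> B \<Longrightarrow> z \<in> P \<or> z \<in> Q" "z \<in> A \<and> z \<in> C \<Longrightarrow> z \<in> P \<or> z \<in> Q"
      "z \<in> B \<and> z \<in> C \<Longrightarrow> z \<in> P \<or> z \<in> Q" for z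
      using \<C> PQ H by auto
    \<comment> \<open>Each of \<open>P\<close> and \<open>Q\<close> comes from one of the three
      covering families and so misses \<open>A\<close>, \<open>B\<close> or \<open>C\<close>. Hence
      some two of these sets have no common point in the union of \<open>P\<close> and
      \<open>Q\<close>, which is the whole space.\<close>
    moreover have "P \<inter> A = {} \<or> P \<inter> B = {} \<or> P \<inter> C = {}" "Q \<inter> A = {} \<or> Q \<inter> B = {} \<or> Q \<inter> C = {}"
      using \<C>(1) PQ H by auto
    ultimately show False using that(4-6) by blast
  qed
  have between: "\<exists>\<G>. finite \<G> \<and> \<G> \<subseteq> \<A> \<and> K \<subseteq> \<Union>\<G> \<and> \<Union>\<G> \<subseteq> U"
    if KU: "closedin X K" "openin X U" "K \<subseteq> U" for K U
  proof -
    \<comment> \<open>By De Morgan, finitely many subbasic sets around \<open>z\<close> whose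
      intersection misses \<open>K\<close> yield a finite cover of \<open>K\<close> by their
      complements, which belong to \<open>\<A>\<close>.\<close>
    have "\<exists>V. openin X V \<and> z \<in> V \<and> (\<exists>\<G>. finite \<G> \<and> \<G> \<subseteq> \<A> \<and> K \<subseteq> \<Union>\<G> \<and> V \<inter> \<Union>\<G> = {})"
      if "z \<in> topspace X - U" for z
    proof -
      have "openin X (topspace X - K)" "z \<in> topspace X - K" using KU that by auto
      then obtain \<U> where U: "finite \<U>" "\<U> \<subseteq> \<B>" "z \<in> \<Inter>\<U>" "topspace X \<inter> \<Inter>\<U> \<subseteq> topspace X - K"
        by (rule subbase_ofE[OF \<B>])
      have "openin X (topspace X \<inter> \<Inter>\<U>)"
        using U opB by (intro openin_Int_Inter) auto
      moreover have "(\<lambda>B. topspace X - B) ` \<U> \<subseteq> \<A>"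
      proof clarify
        fix B assume "B \<in> \<U>"
        then show "topspace X - B \<in> \<A>"
          using U unfolding \<A>_def by (intro CollectI exI[of _ "{B}"]) auto
      qed
      moreover have "K \<subseteq> \<Union>((\<lambda>B. topspace X - B) ` \<U>)"
        using U KU closedin_subset[OF KU(1)] by auto
      ultimately show ?thesis using U that
        by (intro exI[of _ "topspace X \<inter> \<Inter>\<U>"] conjI exI[of _ "(\<lambda>B. topspace X - B) ` \<U>"]) auto
    qed
    then obtain V \<G> where V: "\<And>z. z \<in> topspace X - U \<Longrightarrow> openin X (V z) \<and> z \<in> V z \<and>
        finite (\<G> z) \<and> \<G> z \<subseteq> \<A> \<and> K \<subseteq> \<Union>(\<G> z) \<and> V z \<inter> \<Union>(\<G> z) = {}"
      by metis
    have "compactin X (topspace X - U)"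
      using KU assms(2) by (simp add: closedin_compact_space closedin_diff)
    moreover have "\<forall>W\<in>V ` (topspace X - U). openin X W" "topspace X - U \<subseteq> \<Union>(V ` (topspace X - U))"
      using V by auto
    ultimately obtain \<F> where "finite \<F>" "\<F> \<subseteq> V ` (topspace X - U)" "topspace X - U \<subseteq> \<Union>\<F>"
      unfolding compactin_def by meson
    then obtain Z where Z: "finite Z" "Z \<subseteq> topspace X - U" "topspace X - U \<subseteq> \<Union>(V ` Z)"
      by (metis finite_subset_image)
    have "\<exists>\<G>'. finite \<G>' \<and> \<G>' \<subseteq> \<A> \<and> K \<subseteq> \<Union>\<G>' \<and> (\<forall>z\<in>Z. V z \<inter> \<Union>\<G>' = {})"
      using Z(1,2)
    proof (induction Z)
      case empty
      have "topspace X \<in> \<A>" unfolding \<A>_def by (intro CollectI exI[of _ "{}"]) auto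
      then show ?case using closedin_subset[OF KU(1)] by (intro exI[of _ "{topspace X}"]) auto
    next
      case (insert z Z)
      then obtain \<G>' where G: "finite \<G>'" "\<G>' \<subseteq> \<A>" "K \<subseteq> \<Union>\<G>'" "\<And>z. z \<in> Z \<Longrightarrow> V z \<inter> \<Union>\<G>' = {}"
        by auto
      have Vz: "finite (\<G> z)" "\<G> z \<subseteq> \<A>" "K \<subseteq> \<Union>(\<G> z)" "V z \<inter> \<Union>(\<G> z) = {}"
        using V insert.prems by auto
      \<comment> \<open>The union of the pairwise intersections is the intersection of the two
        unions, so it still covers \<open>K\<close> and misses the earlier neighbourhoods as well as
        \<open>V z\<close>.\<close>
      let ?H = "(\<lambda>(A, B). A \<inter> B) ` (\<G>' \<times> \<G> z)"
      have un: "\<Union>?H = \<Union>\<G>' \<inter> \<Union>(\<G> z)" by auto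
      have "?H \<subseteq> \<A>" using Int_\<A> G(2) Vz(2) by auto
      moreover have "finite ?H" using G(1) Vz(1) by simp
      moreover have "K \<subseteq> \<Union>?H" unfolding un using G(3) Vz(3) by blast
      moreover have "\<forall>w\<in>insert z Z. V w \<inter> \<Union>?H = {}" unfolding un using G(4) Vz(4) by blast
      ultimately show ?case by blast
    qed
    then obtain \<G>' where G: "finite \<G>'" "\<G>' \<subseteq> \<A>" "K \<subseteq> \<Union>\<G>'" "\<And>z. z \<in> Z \<Longrightarrow> V z \<inter> \<Union>\<G>' = {}"
      by auto
    have "\<Union>\<G>' \<subseteq> topspace X" using G(2) closed closedin_subset by blast
    then have "\<Union>\<G>' \<subseteq> U" using Z(3) G(4) by blast
    with G show ?thesis by blast
  qed
  show thesis by (rule that[OF closed binary between])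
qed

lemma compact_space_discrete_compactification: "compact_space (discrete_compactification D)"
  unfolding compact_space_alt
proof (intro allI impI)
  fix \<U> assume U: "Ball \<U> (openin (discrete_compactification D)) \<and>
    topspace (discrete_compactification D) \<subseteq> \<Union>\<U>"
  then obtain V where V: "V \<in> \<U>" "None \<in> V" by auto
  with U have "finite (insert None (Some ` D) - V)"
    using openin_discrete_compactification by blast
  moreover have "insert None (Some ` D) - V \<subseteq> \<Union>\<U>" using U by auto
  ultimately obtain \<F> where "finite \<F>" "\<F> \<subseteq> \<U>" "insert None (Some ` D) - V \<subseteq> \<Union>\<F>"
    by (rule finite_subset_Union)
  then show "\<exists>\<F>. finite \<F> \<and> \<F> \<subseteq> \<U> \<and> topspace (discrete_compactification D) \<subseteq> \<Union>\<F>"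
    using V by (intro exI[of _ "insert V \<F>"]) auto
qed

text \<open>If \<open>A\<close> does not contain \<open>S\<close>, the induction continues on
  \<open>S - A\<close>, which is relatively open in \<open>S\<close> because \<open>A\<close> is
  closed; removing \<open>A\<close> from the open set found there transfers the result to
  \<open>S\<close>.\<close>

lemma finite_closed_cover_contains_relatively_open:
  fixes S :: "'a::topological_space set"
  assumes "finite \<F>" "\<And>A. A \<in> \<F> \<Longrightarrow> closed A" "S \<subseteq> \<Union>\<F>" "S \<noteq> {}"
  shows "\<exists>A\<in>\<F>. \<exists>V. open V \<and> V \<inter> S \<noteq> {} \<and> V \<inter> S \<subseteq> A"
  using assms
proof (induction \<F> arbitrary: S)
  case (insert A \<F>)
  show ?case
  proof (cases "S \<subseteq> A")
    case True
    then show ?thesis using insert.prems by (intro bexI[of _ A] exI[of _ UNIV]) auto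
  next
    case False
    moreover have "S - A \<subseteq> \<Union>\<F>" using insert.prems(2) by auto
    ultimately obtain B V where BV: "B \<in> \<F>" "open V" "V \<inter> (S - A) \<noteq> {}" "V \<inter> (S - A) \<subseteq> B"
      using insert.IH[of "S - A"] insert.prems(1) by auto
    have "V \<inter> (S - A) = (V - A) \<inter> S" by blast
    with BV have "(V - A) \<inter> S \<noteq> {}" "(V - A) \<inter> S \<subseteq> B" by simp_all
    moreover have "open (V - A)" using BV insert.prems(1) by (simp add: open_Diff)
    ultimately show ?thesis using \<open>B \<in> \<F>\<close> by blast
  qed
qed auto

section \<open>Non-meager sets of reals and coded closed sets\<close>

lemma meager_Un_nowhere_dense:
  fixes S :: "real set"
  assumes "countable S" "nowhere_dense T"
  shows "meager (S \<union> T)"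
proof -
  let ?F = "insert T ((\<lambda>x. {x}) ` S)"
  have "countable ?F" using assms(1) by simp
  moreover have "\<forall>N\<in>?F. nowhere_dense N" using assms(2) by (simp add: nowhere_dense_def)
  moreover have "S \<union> T = \<Union>?F" by auto
  ultimately show ?thesis unfolding meager_def by blast
qed

lemma meager_UN:
  assumes "countable I" "\<And>i. i \<in> I \<Longrightarrow> meager (S i)"
  shows "meager (\<Union>i\<in>I. S i)"
proof -
  from assms(2) obtain \<F> where "\<And>i. i \<in> I \<Longrightarrow> countable (\<F> i) \<and> (\<forall>N\<in>\<F> i. nowhere_dense N) \<and> S i = \<Union>(\<F> i)"
    unfolding meager_def by metis
  then have "countable (\<Union>i\<in>I. \<F> i)" "\<forall>N\<in>\<Union>i\<in>I. \<F> i. nowhere_dense N"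
    "(\<Union>i\<in>I. S i) = \<Union>(\<Union>i\<in>I. \<F> i)"
    using assms(1) by auto
  then show ?thesis unfolding meager_def by blast
qed

text \<open>Otherwise the basic open sets that meet \<open>N\<close> in a countable set have a dense
  union \<open>G\<close>. Then \<open>N \<inter> G\<close> is countable and \<open>N - G\<close> is
  nowhere dense, so \<open>N\<close> is meager.\<close>

lemma non_meager_locally_uncountable:
  fixes N :: "real set"
  assumes "\<not> meager N"
  shows "\<exists>I. open I \<and> I \<noteq> {} \<and> (\<forall>J. open J \<and> J \<noteq> {} \<and> J \<subseteq> I \<longrightarrow> uncountable (N \<inter> J))"
proof (rule ccontr)
  assume "\<nexists>I. open I \<and> I \<noteq> {} \<and> (\<forall>J. open J \<and> J \<noteq> {} \<and> J \<subseteq> I \<longrightarrow> uncountable (N \<inter> J))"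
  then have small: "\<exists>J. open J \<and> J \<noteq> {} \<and> J \<subseteq> I \<and> countable (N \<inter> J)" if "open I" "I \<noteq> {}" for I
    using that by blast
  obtain \<D> :: "real set set" where \<D>: "countable \<D>" "topological_basis \<D>"
    using ex_countable_basis by blast
  define G where "G = \<Union>{B \<in> \<D>. countable (N \<inter> B)}"
  have "open G" unfolding G_def using topological_basis_open[OF \<D>(2)] by auto
  have "countable (\<Union>B\<in>{B \<in> \<D>. countable (N \<inter> B)}. N \<inter> B)"
    using \<D>(1) by (intro countable_UN) auto
  then have "countable (N \<inter> G)" unfolding G_def Int_Union by (rule back_subst) auto
  moreover have "nowhere_dense (N - G)"
    unfolding nowhere_dense_def
  proof (rule ccontr)
    assume "interior (closure (N - G)) \<noteq> {}"
    then obtain J where J: "open J" "J \<noteq> {}" "J \<subseteq> interior (closure (N - G))" "countable (N \<inter> J)"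
      using small[of "interior (closure (N - G))"] by auto
    then obtain B where "B \<in> \<D>" "B \<noteq> {}" "B \<subseteq> J"
      using topological_basisE[OF \<D>(2) \<open>open J\<close>] by (metis all_not_in_conv)
    moreover have "countable (N \<inter> B)" using J \<open>B \<subseteq> J\<close> by (auto intro: countable_subset[of _ "N \<inter> J"])
    ultimately have "B \<subseteq> G" by (auto simp: G_def)
    have "B \<subseteq> closure (N - G)" using J \<open>B \<subseteq> J\<close> interior_subset by blast
    moreover have "closure (N - G) \<subseteq> - G" using \<open>open G\<close> by (intro closure_minimal) auto
    ultimately show False using \<open>B \<subseteq> G\<close> \<open>B \<noteq> {}\<close> by blast
  qed
  ultimately have "meager ((N \<inter> G) \<union> (N - G))" by (rule meager_Un_nowhere_dense)
  then show False using assms by (simp add: Int_Diff_Un)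
qed

section \<open>Base-4 digits and cylinders\<close>

definition digit4 :: "nat \<Rightarrow> real \<Rightarrow> int" where
  "digit4 p x = \<lfloor>4 ^ p * x\<rfloor> mod 4"

lemma floor_power4_div:
  fixes x :: real
  assumes "p \<le> M"
  shows "\<lfloor>4 ^ p * x\<rfloor> = \<lfloor>4 ^ M * x\<rfloor> div 4 ^ (M - p)"
proof -
  have "(4::real) ^ M = 4 ^ p * 4 ^ (M - p)" using assms by (simp flip: power_add)
  then have "4 ^ p * x = (4 ^ M * x) / real_of_int (4 ^ (M - p))" by simp
  then show ?thesis by (metis floor_divide_real_eq_div zero_le_numeral zero_le_power)
qed

lemma digit4_cong:
  assumes "p \<le> M" "\<lfloor>4 ^ M * x\<rfloor> = \<lfloor>4 ^ M * y\<rfloor>"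
  shows "digit4 p x = digit4 p y"
  unfolding digit4_def using floor_power4_div[OF assms(1)] assms(2) by simp

text \<open>Lets digits be chosen freely after a fixed beginning. Passing from order
  \<open>k\<close> to \<open>Suc k\<close> appends one digit, which turns \<open>c'\<close> into
  \<open>4 * c' + e (Suc k)\<close>.\<close>

lemma digit4_prescribe:
  assumes "M \<le> M'" "\<And>p. 0 \<le> e p \<and> e p < (4::int)"
  shows "\<exists>c'. \<forall>x::real. \<lfloor>4 ^ M' * x\<rfloor> = c' \<longrightarrow>
    \<lfloor>4 ^ M * x\<rfloor> = c \<and> (\<forall>p. M < p \<and> p \<le> M' \<longrightarrow> digit4 p x = e p)"
  using assms(1)
proof (induction M' rule: dec_induct)
  case (step k)
  then obtain c' where c': "\<And>x::real. \<lfloor>4 ^ k * x\<rfloor> = c' \<Longrightarrow>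
    \<lfloor>4 ^ M * x\<rfloor> = c \<and> (\<forall>p. M < p \<and> p \<le> k \<longrightarrow> digit4 p x = e p)"
    by metis
  have "\<lfloor>4 ^ M * x\<rfloor> = c \<and> (\<forall>p. M < p \<and> p \<le> Suc k \<longrightarrow> digit4 p x = e p)"
    if x: "\<lfloor>4 ^ Suc k * x\<rfloor> = 4 * c' + e (Suc k)" for x :: real
  proof -
    have "\<lfloor>4 ^ k * x\<rfloor> = c'"
      using floor_power4_div[of k "Suc k" x] x assms(2)[of "Suc k"] by simp
    moreover have "digit4 (Suc k) x = e (Suc k)"
      using x assms(2)[of "Suc k"] unfolding digit4_def by simp
    ultimately show ?thesis using c' by (metis le_Suc_eq)
  qed
  then show ?case by blast
qed auto

text \<open>A cylinder, the set of \<open>x\<close> with a given floor of \<open>4 ^ M * x\<close>,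
  is a half-open interval of length \<open>1 / 4 ^ M\<close>. This lemma and the next pass between
  nonempty open sets and conditions on the integer part and finitely many digits.\<close>

lemma open_contains_cylinder:
  fixes I :: "real set"
  assumes "open I" "I \<noteq> {}"
  obtains M c where "\<And>x. \<lfloor>4 ^ M * x\<rfloor> = c \<Longrightarrow> x \<in> I"
proof -
  obtain x0 e where e: "e > 0" "ball x0 e \<subseteq> I" using assms by (metis all_not_in_conv openE)
  obtain M where "(1/4) ^ M < e" using real_arch_pow_inv[of e "1/4"] e by auto
  then have small: "1 / 4 ^ M < e" by (simp add: power_one_over)
  have "x \<in> I" if "\<lfloor>4 ^ M * x\<rfloor> = \<lfloor>4 ^ M * x0\<rfloor>" for x
  proof -
    have "\<bar>4 ^ M * x - 4 ^ M * x0\<bar> < 1" using that by linarith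
    then have "4 ^ M * \<bar>x - x0\<bar> < 1" by (simp add: abs_mult flip: right_diff_distrib)
    then have "\<bar>x - x0\<bar> < 1 / 4 ^ M" by (simp add: field_simps)
    then show ?thesis using small e by (auto simp: dist_real_def subset_iff)
  qed
  then show thesis by (rule that)
qed

lemma cylinder_contains_open:
  obtains J :: "real set" where "open J" "J \<noteq> {}" "\<And>x. x \<in> J \<Longrightarrow> \<lfloor>4 ^ M * x\<rfloor> = c"
proof
  let ?J = "{real_of_int c / 4 ^ M <..< (real_of_int c + 1) / 4 ^ M}"
  show "open ?J" "?J \<noteq> {}" by (simp_all add: divide_strict_right_mono not_le)
  show "\<lfloor>4 ^ M * x\<rfloor> = c" if "x \<in> ?J" for x
    using that by (simp add: field_simps floor_eq_iff)
qed

text \<open>The nodes of the binary tree are numbered as in a heap: the root is \<open>1\<close>, the children of \<open>q\<close> are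
  \<open>2 * q\<close> and \<open>2 * q + 1\<close>, and \<open>q\<close> is on level \<open>n\<close> iff \<open>q div 2 ^ n = 1\<close>. The digit of \<open>x\<close> with index \<open>q\<close>
  deletes the left child of \<open>q\<close>, the right child, or none.\<close>

fun alive :: "real \<Rightarrow> nat \<Rightarrow> bool" where
  "alive x q = (if q \<le> 1 then q = 1
     else alive x (q div 2) \<and> digit4 (q div 2) x \<noteq> int (q mod 2))"

declare alive.simps [simp del]

text \<open>The nodes of level \<open>n\<close> are \<open>2 ^ n\<close> to
  \<open>2 * 2 ^ n - 1\<close>; scaling and subtracting 1 sends them to the left ends of the dyadic
  intervals of length \<open>1 / 2 ^ n\<close> in \<open>[0,1]\<close>.\<close>

definition cell :: "nat \<Rightarrow> nat \<Rightarrow> real set" where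
  "cell n q = {real q / 2 ^ n - 1 .. (real q + 1) / 2 ^ n - 1}"

definition tree_set :: "real \<Rightarrow> real set" where
  "tree_set x = (\<Inter>n. \<Union>q\<in>{q. q div 2 ^ n = 1 \<and> alive x q}. cell n q)"

section \<open>Levels of the tree, alive nodes and nesting of cells\<close>

lemma level_bounds:
  fixes q :: nat
  shows "q div 2 ^ n = 1 \<longleftrightarrow> 2 ^ n \<le> q \<and> q < 2 * 2 ^ n"
proof
  assume *: "q div 2 ^ n = 1"
  have "q = 2 ^ n * (q div 2 ^ n) + q mod 2 ^ n" by simp
  moreover have "q mod 2 ^ n < 2 ^ n" by simp
  ultimately show "2 ^ n \<le> q \<and> q < 2 * 2 ^ n" unfolding * by linarith
next
  assume "2 ^ n \<le> q \<and> q < 2 * 2 ^ n"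
  then show "q div 2 ^ n = 1" by (intro div_nat_eqI) auto
qed

lemma level_div: "(q div 2 ^ k) div 2 ^ n = 1 \<longleftrightarrow> q div 2 ^ (n + k) = 1" for q :: nat
  by (simp add: div_mult2_eq power_add mult.commute)

lemma level_unique:
  fixes q :: nat
  assumes "q div 2 ^ m = 1" "q div 2 ^ n = 1"
  shows "m = n"
proof (rule ccontr)
  assume "m \<noteq> n"
  then consider "Suc m \<le> n" | "Suc n \<le> m" by linarith
  then show False
  proof cases
    case 1
    then have "(2::nat) ^ Suc m \<le> 2 ^ n" by (intro power_increasing) auto
    then show False using assms unfolding level_bounds by simp
  next
    case 2
    then have "(2::nat) ^ Suc n \<le> 2 ^ m" by (intro power_increasing) auto
    then show False using assms unfolding level_bounds by simp
  qed
qed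

lemma finite_level: "finite {q::nat. q div 2 ^ n = 1 \<and> P q}"
  unfolding level_bounds by (rule finite_subset[of _ "{..<2 * 2 ^ n}"]) auto

lemma alive_child:
  assumes "q > 0"
  shows "alive x (2 * q) \<longleftrightarrow> alive x q \<and> digit4 q x \<noteq> 0"
    and "alive x (Suc (2 * q)) \<longleftrightarrow> alive x q \<and> digit4 q x \<noteq> 1"
  using assms by (subst alive.simps, simp)+

lemma alive_pos: "alive x q \<Longrightarrow> q > 0"
  by (cases "q = 0") (auto simp: alive.simps)

lemma alive_ancestor:
  assumes "alive x q" "q div 2 ^ k > 0"
  shows "alive x (q div 2 ^ k)"
  using assms
proof (induction k arbitrary: q)
  case (Suc k)
  have eq: "q div 2 ^ Suc k = (q div 2) div 2 ^ k" by (simp add: div_mult2_eq)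
  have "q > 1" using Suc.prems(2) unfolding eq by (cases "q > 1") auto
  then have "alive x (q div 2)" using Suc.prems(1) by (subst (asm) alive.simps) simp
  then show ?case using Suc.IH Suc.prems(2) unfolding eq by blast
qed auto

text \<open>Whether \<open>q\<close> is alive depends only on the digits at its proper ancestors,
  the largest of which is \<open>q div 2\<close>.\<close>

lemma alive_cong:
  assumes "q div 2 \<le> M" "\<lfloor>4 ^ M * x\<rfloor> = \<lfloor>4 ^ M * y\<rfloor>"
  shows "alive x q \<longleftrightarrow> alive y q"
  using assms(1)
proof (induction q rule: less_induct)
  case (less q)
  show ?case
  proof (cases "q \<le> 1")
    case False
    then have "alive x (q div 2) \<longleftrightarrow> alive y (q div 2)"
      using less by auto
    moreover have "digit4 (q div 2) x = digit4 (q div 2) y"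
      using digit4_cong less.prems assms(2) by blast
    ultimately show ?thesis by (simp add: alive.simps[of _ q])
  qed (simp add: alive.simps)
qed

lemma cell_mono: "cell (n + k) q \<subseteq> cell n (q div 2 ^ k)"
proof -
  have "q = 2 ^ k * (q div 2 ^ k) + q mod 2 ^ k" "q mod 2 ^ k < 2 ^ k" by simp_all
  then have "2 ^ k * (q div 2 ^ k) \<le> q" "q + 1 \<le> 2 ^ k * (q div 2 ^ k) + 2 ^ k" by linarith+
  then have "real (2 ^ k * (q div 2 ^ k)) \<le> real q"
    "real (q + 1) \<le> real (2 ^ k * (q div 2 ^ k) + 2 ^ k)"
    unfolding of_nat_le_iff .
  then have "real (q div 2 ^ k) \<le> real q / 2 ^ k" "(real q + 1) / 2 ^ k \<le> real (q div 2 ^ k) + 1"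
    by (simp_all add: field_simps)
  then have "real (q div 2 ^ k) / 2 ^ n \<le> (real q / 2 ^ k) / 2 ^ n"
    "((real q + 1) / 2 ^ k) / 2 ^ n \<le> (real (q div 2 ^ k) + 1) / 2 ^ n"
    by (intro divide_right_mono; simp)+
  then show ?thesis unfolding cell_def by (simp add: power_add mult.commute)
qed

text \<open>There are no dead ends: digit 0 deletes the left child, 1 the right one, 2 and 3
  neither, so an alive node always has an alive child. Iterating the choice gives the
  branch.\<close>

lemma alive_branch:
  assumes "alive x p"
  obtains Q where "Q 0 = p" "\<And>j. alive x (Q j)" "\<And>i j. Q (i + j) div 2 ^ j = Q i"
proof -
  have "\<exists>r. alive x r \<and> r div 2 = q" if "alive x q" for q
  proof (cases "digit4 q x = 0")
    case True
    then have "alive x (Suc (2 * q))" using that alive_child alive_pos by simp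
    then show ?thesis by (intro exI[of _ "Suc (2 * q)"]) simp
  next
    case False
    then have "alive x (2 * q)" using that alive_child alive_pos by simp
    then show ?thesis by (intro exI[of _ "2 * q"]) simp
  qed
  then obtain f where f: "\<And>q. alive x q \<Longrightarrow> alive x (f q) \<and> f q div 2 = q" by metis
  define Q where "Q j = (f ^^ j) p" for j
  have al: "alive x (Q j)" for j by (induction j) (auto simp: Q_def assms f)
  have "Q (i + j) div 2 ^ j = Q i" for i j
  proof (induction j)
    case (Suc j)
    have "Q (i + Suc j) div 2 ^ Suc j = (Q (Suc (i + j)) div 2) div 2 ^ j" by (simp add: div_mult2_eq)
    also have "Q (Suc (i + j)) div 2 = Q (i + j)" using f[OF al] by (simp add: Q_def)
    finally show ?case using Suc by simp
  qed simp
  then show thesis using that[of Q] al by (simp add: Q_def)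
qed

section \<open>The closed sets coded by pruned trees\<close>

lemma closed_tree_set: "closed (tree_set x)"
  unfolding tree_set_def cell_def by (intro closed_INT ballI closed_UN finite_level) auto

lemma tree_set_subset: "tree_set x \<subseteq> {0..1}"
proof -
  have "tree_set x \<subseteq> (\<Union>q\<in>{q. q div 2 ^ 0 = 1 \<and> alive x q}. cell 0 q)"
    unfolding tree_set_def by blast
  also have "\<dots> \<subseteq> {0..1}" by (auto simp: cell_def)
  finally show ?thesis .
qed

text \<open>The cells along an alive branch through \<open>p\<close> are nested and compact. A
  common point lies in \<open>tree_set x\<close>: ancestors of \<open>p\<close> witness the levels
  up to \<open>n\<close>, the branch witnesses the later ones.\<close>

lemma tree_set_meets_cell:
  assumes "alive x p" "p div 2 ^ n = 1"
  shows "tree_set x \<inter> cell n p \<noteq> {}"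
proof -
  obtain Q where Q: "Q 0 = p" "\<And>j. alive x (Q j)" "\<And>i j. Q (i + j) div 2 ^ j = Q i"
    using alive_branch[OF assms(1)] by blast
  have anti: "cell (n + j) (Q j) \<subseteq> cell (n + i) (Q i)" if "i \<le> j" for i j
    using cell_mono[of "n + i" "j - i" "Q j"] Q(3)[of i "j - i"] that by simp
  have "(\<Inter>j. cell (n + j) (Q j)) \<noteq> {}"
    by (rule compact_nest) (use anti in \<open>auto simp: cell_def divide_right_mono\<close>)
  then obtain t where t: "\<And>j. t \<in> cell (n + j) (Q j)" by auto
  have "\<exists>q. q div 2 ^ m = 1 \<and> alive x q \<and> t \<in> cell m q" for m
  proof (cases "m \<le> n")
    case True
    have lev: "(p div 2 ^ (n - m)) div 2 ^ m = 1"
      using assms(2) True by (subst level_div) simp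
    then have "p div 2 ^ (n - m) > 0" by (cases "p div 2 ^ (n - m) = 0") auto
    then have "alive x (p div 2 ^ (n - m))" using alive_ancestor assms(1) by blast
    moreover have "t \<in> cell m (p div 2 ^ (n - m))"
      using t[of 0] Q(1) cell_mono[of m "n - m" p] True by auto
    ultimately show ?thesis using lev by blast
  next
    case False
    then have "Q (m - n) div 2 ^ m = 1"
      using level_div[of "Q (m - n)" "m - n" n] Q(3)[of 0 "m - n"] Q(1) assms(2) by simp
    then show ?thesis using Q(2) t[of "m - n"] False by auto
  qed
  then have "t \<in> tree_set x" unfolding tree_set_def by blast
  moreover have "t \<in> cell n p" using t[of 0] Q(1) by simp
  ultimately show ?thesis by blast
qed

lemma tree_set_nonempty: "tree_set x \<noteq> {}"
  using tree_set_meets_cell[of x 1 0] by (auto simp: alive.simps)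

lemma tree_set_cell_in_open:
  assumes "open V" "V \<inter> tree_set x \<noteq> {}"
  obtains n p where "p div 2 ^ n = 1" "alive x p" "cell n p \<subseteq> V"
proof -
  obtain t where t: "t \<in> V" "t \<in> tree_set x" using assms by auto
  obtain e where e: "e > 0" "ball t e \<subseteq> V" using assms(1) t by (meson openE)
  obtain n where "(1/2) ^ n < e" using real_arch_pow_inv[of e "1/2"] e by auto
  then have n: "1 / 2 ^ n < e" by (simp add: power_one_over)
  have "t \<in> (\<Union>q\<in>{q. q div 2 ^ n = 1 \<and> alive x q}. cell n q)"
    using t unfolding tree_set_def by blast
  then obtain p where p: "p div 2 ^ n = 1" "alive x p" "t \<in> cell n p" by blast
  have "\<bar>u - t\<bar> \<le> 1 / 2 ^ n" if "u \<in> cell n p" for u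
    using that p(3) unfolding cell_def by (auto simp: add_divide_distrib)
  then have "cell n p \<subseteq> ball t e" using n by (fastforce simp: dist_real_def)
  then show thesis using that p e by blast
qed

text \<open>An open condition on \<open>x\<close> can be secured by fixing finitely many digits.
  Below a sufficiently deep alive node \<open>p'\<close> the digits are still free, so the subtree
  there can be pruned to the paths leading towards any finite set \<open>T\<close>, down to a level
  finer than \<open>\<delta>\<close>.\<close>

lemma tree_set_approximates:
  assumes I: "open I" "I \<noteq> {}"
    and dense: "\<And>J. open J \<Longrightarrow> J \<noteq> {} \<Longrightarrow> J \<subseteq> I \<Longrightarrow> \<exists>x\<in>J. alive x p"
    and "p div 2 ^ n = 1"
  obtains a b where "a < b" "{a<..<b} \<subseteq> cell n p"
    and "\<And>T \<delta>. finite T \<Longrightarrow> T \<noteq> {} \<Longrightarrow> T \<subseteq> {a<..<b} \<Longrightarrow> \<delta> > 0 \<Longrightarrow>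
      \<exists>J. open J \<and> J \<noteq> {} \<and> J \<subseteq> I \<and> (\<forall>x\<in>J. tree_set x \<inter> {a<..<b} \<subseteq> (\<Union>t\<in>T. ball t \<delta>) \<and>
        (\<forall>t\<in>T. tree_set x \<inter> ball t \<delta> \<noteq> {}))"
proof -
  obtain M0 c0 where M0: "\<And>x. \<lfloor>4 ^ M0 * x\<rfloor> = c0 \<Longrightarrow> x \<in> I"
    using open_contains_cylinder[OF I] by metis
  obtain J0 :: "real set" where J0: "open J0" "J0 \<noteq> {}" "\<And>x. x \<in> J0 \<Longrightarrow> \<lfloor>4 ^ M0 * x\<rfloor> = c0"
    using cylinder_contains_open[of M0 c0] by blast
  then obtain x0 where x0: "x0 \<in> J0" "alive x0 p" using dense[of J0] M0 by blast
  \<comment> \<open>Going down \<open>M0\<close> further levels makes \<open>2 ^ n'\<close> exceed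
    \<open>M0\<close>, so the cylinder given by \<open>c0\<close> fixes no digit of a node on level
    \<open>n'\<close> or later.\<close>
  define n' where "n' = n + M0"
  obtain Q where Q: "Q 0 = p" "\<And>j. alive x0 (Q j)" "\<And>i j. Q (i + j) div 2 ^ j = Q i"
    using alive_branch[OF x0(2)] by blast
  define p' where "p' = Q M0"
  have p'p: "p' div 2 ^ M0 = p" using Q(3)[of 0 M0] Q(1) by (simp add: p'_def)
  have lev': "p' div 2 ^ n' = 1"
    using assms(4) p'p level_div[of p' M0 n] by (simp add: n'_def)
  \<comment> \<open>The last number before level \<open>n'\<close>: digits up to \<open>M\<close>
    decide whether \<open>p'\<close> is alive, and all digits in the subtree of \<open>p'\<close>
    come later.\<close>
  define M where "M = 2 ^ n' - (1::nat)"
  define c where "c = \<lfloor>4 ^ M * x0\<rfloor>"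
  have "M0 < 2 ^ M0" by (rule less_exp)
  also have "(2::nat) ^ M0 \<le> 2 ^ n'" unfolding n'_def by (intro power_increasing) auto
  finally have "M0 \<le> M" by (simp add: M_def)
  have cylI: "x \<in> I" if "\<lfloor>4 ^ M * x\<rfloor> = c" for x
    using that floor_power4_div[OF \<open>M0 \<le> M\<close>] J0(3)[OF x0(1)] M0 by (simp add: c_def)
  have alive_p': "alive x p'" if "\<lfloor>4 ^ M * x\<rfloor> = c" for x
  proof -
    have "p' div 2 \<le> M" using lev' unfolding level_bounds M_def by linarith
    then show ?thesis using alive_cong[of p' M x x0] that Q(2) by (simp add: c_def p'_def)
  qed
  \<comment> \<open>The ends of \<open>cell n' p'\<close>, chosen before \<open>T\<close> and
    \<open>\<delta>\<close> are known.\<close>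
  define a where "a = real p' / 2 ^ n' - 1"
  define b where "b = (real p' + 1) / 2 ^ n' - 1"
  have "a < b" by (simp add: a_def b_def divide_strict_right_mono)
  have "{a<..<b} \<subseteq> cell n' p'" by (auto simp: cell_def a_def b_def)
  then have sub: "{a<..<b} \<subseteq> cell n p" using cell_mono[of n M0 p'] p'p by (auto simp: n'_def)
  have approx: "\<exists>J. open J \<and> J \<noteq> {} \<and> J \<subseteq> I \<and> (\<forall>x\<in>J. tree_set x \<inter> {a<..<b} \<subseteq> (\<Union>t\<in>T. ball t \<delta>) \<and>
        (\<forall>t\<in>T. tree_set x \<inter> ball t \<delta> \<noteq> {}))"
    if T: "finite T" "T \<noteq> {}" "T \<subseteq> {a<..<b}" "\<delta> > 0" for T \<delta>
  proof -
    obtain k where k: "(1/2) ^ k < \<delta>" using real_arch_pow_inv[of \<delta> "1/2"] T by auto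
    define m where "m = n' + k"
    have "(1/2::real) ^ m \<le> (1/2) ^ k" unfolding m_def by (intro power_decreasing) auto
    then have m: "1 / 2 ^ m < \<delta>" using k by (simp add: power_one_over)
    define s where "s t = nat \<lfloor>2 ^ m * (1 + t)\<rfloor>" for t :: real
    have s: "t \<in> cell m (s t)" "s t div 2 ^ k = p'" if "t \<in> T" for t
    proof -
      have t: "real p' < 2 ^ n' * (1 + t)" "2 ^ n' * (1 + t) < real p' + 1"
        using that T(3) by (auto simp: a_def b_def field_simps)
      then have "1 + t > 0"
        by (metis of_nat_0_le_iff le_less_trans zero_less_mult_pos zero_less_numeral zero_less_power)
      then have pos: "\<lfloor>2 ^ m * (1 + t)\<rfloor> \<ge> 0" by simp
      then have "real (s t) = of_int \<lfloor>2 ^ m * (1 + t)\<rfloor>" by (simp add: s_def)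
      then have "real (s t) \<le> 2 ^ m * (1 + t)" "2 ^ m * (1 + t) \<le> real (s t) + 1" by linarith+
      then show "t \<in> cell m (s t)" by (simp add: cell_def field_simps)
      have "\<lfloor>2 ^ n' * (1 + t)\<rfloor> = int p'" using t by (simp add: floor_eq_iff)
      moreover have "2 ^ n' * (1 + t) = 2 ^ m * (1 + t) / real_of_int (2 ^ k)"
        by (simp add: m_def power_add)
      ultimately have "\<lfloor>2 ^ m * (1 + t)\<rfloor> div 2 ^ k = int p'"
        by (metis floor_divide_real_eq_div zero_le_numeral zero_le_power)
      then show "s t div 2 ^ k = p'"
        using pos unfolding s_def by (metis nat_div_distrib nat_int nat_numeral nat_power_eq zero_le_numeral)
    qed
    have lev_s: "s t div 2 ^ m = 1" if "t \<in> T" for t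
      using level_div[of "s t" k n'] s(2)[OF that] lev' by (simp add: m_def)
    \<comment> \<open>The nodes to be kept alive below \<open>p'\<close>: the nodes
      \<open>s t\<close> of level \<open>m\<close> and their ancestors.\<close>
    define R where "R = {s t div 2 ^ j | t j. t \<in> T}"
    have R_div: "q div 2 \<in> R" if "q \<in> R" for q
    proof -
      from that obtain t j where "t \<in> T" "q = s t div 2 ^ j" by (auto simp: R_def)
      then have "t \<in> T" "q div 2 = s t div 2 ^ Suc j"
        unfolding power_Suc2 div_mult2_eq by simp_all
      then show ?thesis unfolding R_def by blast
    qed
    have R_child: "2 * q \<in> R \<or> Suc (2 * q) \<in> R" if q: "q \<in> R" "q div 2 ^ i = 1" "i < m" for q i
    proof -
      obtain t j where tj: "t \<in> T" "q = s t div 2 ^ j" using q by (auto simp: R_def)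
      have "j \<noteq> 0" using level_unique[of q i m] lev_s[of t] tj q by (cases "j = 0") auto
      then obtain j' where j': "j = Suc j'" by (cases j) auto
      then have "q = (s t div 2 ^ j') div 2" using tj(2) unfolding j' power_Suc2 div_mult2_eq by simp
      then have "s t div 2 ^ j' = 2 * q \<or> s t div 2 ^ j' = Suc (2 * q)" by linarith
      moreover have "s t div 2 ^ j' \<in> R" unfolding R_def using tj(1) by blast
      ultimately show ?thesis by metis
    qed
    \<comment> \<open>The digit deletes a child outside \<open>R\<close>. By \<open>R_child\<close>,
      a node of \<open>R\<close> above level \<open>m\<close> has at most one such child, so one
      deletion is enough.\<close>
    define e :: "nat \<Rightarrow> int" where
      "e q = (if Suc (2 * q) \<notin> R then 1 else if 2 * q \<notin> R then 0 else 2)" for q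
    have "M \<le> 2 ^ m" unfolding M_def m_def
      by (rule order_trans[of _ "2 ^ n'"]) (auto intro: power_increasing)
    moreover have "0 \<le> e q \<and> e q < 4" for q by (simp add: e_def)
    ultimately obtain c' where c': "\<And>x::real. \<lfloor>4 ^ (2 ^ m) * x\<rfloor> = c' \<Longrightarrow>
        \<lfloor>4 ^ M * x\<rfloor> = c \<and> (\<forall>q. M < q \<and> q \<le> 2 ^ m \<longrightarrow> digit4 q x = e q)"
      using digit4_prescribe[of M "2 ^ m" e c] by metis
    obtain J :: "real set" where J: "open J" "J \<noteq> {}" "\<And>x. x \<in> J \<Longrightarrow> \<lfloor>4 ^ (2 ^ m) * x\<rfloor> = c'"
      using cylinder_contains_open by blast
    have "tree_set x \<inter> {a<..<b} \<subseteq> (\<Union>t\<in>T. ball t \<delta>) \<and> (\<forall>t\<in>T. tree_set x \<inter> ball t \<delta> \<noteq> {})"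
      if "x \<in> J" for x
    proof -
      have x: "\<lfloor>4 ^ M * x\<rfloor> = c" "\<And>q. M < q \<Longrightarrow> q \<le> 2 ^ m \<Longrightarrow> digit4 q x = e q"
        using c' J(3)[OF that] by auto
      have alive_R: "alive x q \<longleftrightarrow> q \<in> R" if "j \<le> k" "q div 2 ^ j = p'" for j q
        using that
      proof (induction j arbitrary: q)
        case 0
        obtain t where "t \<in> T" using T(2) by auto
        then have "p' \<in> R" using s(2) unfolding R_def by blast
        then show ?case using 0 alive_p'[OF x(1)] by simp
      next
        case (Suc j)
        define r where "r = q div 2"
        have rp: "r div 2 ^ j = p'" using Suc.prems by (simp add: r_def div_mult2_eq)
        then have r_lev: "r div 2 ^ (n' + j) = 1" using level_div[of r j n'] lev' by simp
        have IH: "alive x r \<longleftrightarrow> r \<in> R" using Suc.IH[of r] rp Suc.prems by simp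
        have lt: "n' + j < m" using Suc.prems by (simp add: m_def)
        have "(2::nat) ^ n' \<le> 2 ^ (n' + j)" "2 * 2 ^ (n' + j) \<le> (2::nat) ^ m"
          using lt power_increasing[of "Suc (n' + j)" m "2::nat"] by (auto intro: power_increasing)
        moreover have "M < 2 ^ n'" by (simp add: M_def)
        ultimately have "M < r" "r \<le> 2 ^ m" using r_lev unfolding level_bounds by linarith+
        then have dr: "digit4 r x = e r" using x(2) by blast
        have "r > 0" using r_lev by (cases "r = 0") auto
        consider "q = 2 * r" | "q = Suc (2 * r)" unfolding r_def by linarith
        then show ?case
        proof cases
          case 1
          show ?thesis
            using R_div[of q] R_child[of r, OF _ r_lev lt] IH 1
            unfolding 1 alive_child(1)[OF \<open>r > 0\<close>] dr e_def by auto
        next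
          case 2
          show ?thesis
            using R_div[of q] IH 2
            unfolding 2 alive_child(2)[OF \<open>r > 0\<close>] dr e_def by auto
        qed
      qed
      have "y \<in> (\<Union>t\<in>T. ball t \<delta>)" if y: "y \<in> tree_set x" "a < y" "y < b" for y
      proof -
        have "y \<in> (\<Union>q\<in>{q. q div 2 ^ m = 1 \<and> alive x q}. cell m q)"
          using y unfolding tree_set_def by blast
        then obtain q where q: "q div 2 ^ m = 1" "alive x q" "y \<in> cell m q" by blast
        then have "y \<in> cell n' (q div 2 ^ k)" using cell_mono[of n' k q] by (auto simp: m_def)
        then have "real (q div 2 ^ k) \<le> 2 ^ n' * (1 + y)" "2 ^ n' * (1 + y) \<le> real (q div 2 ^ k) + 1"
          unfolding cell_def by (auto simp: field_simps)
        moreover have "real p' < 2 ^ n' * (1 + y)" "2 ^ n' * (1 + y) < real p' + 1"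
          using y unfolding a_def b_def by (auto simp: field_simps)
        \<comment> \<open>Different cells of one level share at most an end point, and
          \<open>y\<close> lies strictly inside \<open>cell n' p'\<close>.\<close>
        ultimately have "q div 2 ^ k = p'" by linarith
        then have "q \<in> R" using alive_R[of k q] q by simp
        then obtain t j where tj: "t \<in> T" "q = s t div 2 ^ j" by (auto simp: R_def)
        then have "s t div 2 ^ (m + j) = 1" using q(1) level_div by blast
        then have "j = 0" using level_unique[of "s t" "m + j" m] lev_s[OF tj(1)] by simp
        then have "y \<in> cell m (s t)" using tj q by simp
        then have "\<bar>t - y\<bar> \<le> 1 / 2 ^ m"
          using s(1)[OF tj(1)] unfolding cell_def by (auto simp: add_divide_distrib)
        then have "y \<in> ball t \<delta>" using m by (simp add: dist_real_def)
        then show ?thesis using tj by blast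
      qed
      moreover have "tree_set x \<inter> ball t \<delta> \<noteq> {}" if "t \<in> T" for t
      proof -
        have "s t \<in> R" using that unfolding R_def by (intro CollectI exI[of _ t] exI[of _ 0]) simp
        then have "alive x (s t)" using alive_R[of k "s t"] s(2)[OF that] by simp
        from tree_set_meets_cell[OF this lev_s[OF that]]
        obtain y where y: "y \<in> tree_set x" "y \<in> cell m (s t)" by blast
        then have "\<bar>t - y\<bar> \<le> 1 / 2 ^ m"
          using s(1)[OF that] unfolding cell_def by (auto simp: add_divide_distrib)
        then show ?thesis using m y by (auto simp: dist_real_def)
      qed
      ultimately show ?thesis by auto
    qed
    moreover have "J \<subseteq> I" using J(3) c' cylI by blast
    ultimately show ?thesis using J by blast
  qed
  show thesis by (rule that[OF \<open>a < b\<close> sub approx])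
qed

section \<open>The product space\<close>

lemma closedin_prod_interval_section:
  assumes "closedin (prod_topology (top_of_set {a..b::real}) Y) G"
  shows "closed {t. (t, z) \<in> G}"
proof (cases "z \<in> topspace Y")
  case True
  then have "continuous_map (top_of_set {a..b}) (prod_topology (top_of_set {a..b}) Y) (\<lambda>t. (t, z))"
    by (simp add: continuous_map_pairedI)
  from closedin_continuous_map_preimage[OF this assms]
  have "closedin (top_of_set {a..b}) {t \<in> {a..b}. (t, z) \<in> G}" by simp
  then have "closed {t \<in> {a..b}. (t, z) \<in> G}" by (meson closed_atLeastAtMost closedin_closed_trans)
  moreover have "{t. (t, z) \<in> G} = {t \<in> {a..b}. (t, z) \<in> G}"
    using closedin_subset[OF assms] by auto
  ultimately show ?thesis by simp
next
  case False
  then have "{t. (t, z) \<in> G} = {}" using closedin_subset[OF assms] by auto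
  then show ?thesis by simp
qed

text \<open>If \<open>(t, None)\<close> is outside \<open>G\<close>, some product neighbourhood of
  it misses \<open>G\<close>, and its second factor omits only finitely many points. Hence
  \<open>t\<close> has a basic neighbourhood \<open>B\<close> over which \<open>G\<close> meets only
  finitely many fibres; the countably many such \<open>B\<close> account for all exceptional
  \<open>d\<close>.\<close>

lemma countable_sections_not_below_infinity:
  fixes S :: "real set"
  assumes "closedin (prod_topology (top_of_set S) (discrete_compactification D)) G"
  shows "countable {d \<in> D. \<exists>t. (t, Some d) \<in> G \<and> (t, None) \<notin> G}"
proof -
  let ?Y = "prod_topology (top_of_set S) (discrete_compactification D)"
  obtain \<D> :: "real set set" where \<D>: "countable \<D>" "topological_basis \<D>"
    using ex_countable_basis by blast
  define e where "e B = {d \<in> D. \<exists>t\<in>B. (t, Some d) \<in> G}" for B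
  have "d \<in> \<Union>(e ` {B \<in> \<D>. finite (e B)})" if d: "d \<in> D" "(t, Some d) \<in> G" "(t, None) \<notin> G" for d t
  proof -
    have "t \<in> S" using d closedin_subset[OF assms] by auto
    then have "(t, None) \<in> topspace ?Y - G" using d by simp
    moreover have "openin ?Y (topspace ?Y - G)" using assms by blast
    ultimately obtain U V where UV: "openin (top_of_set S) U" "openin (discrete_compactification D) V"
      "t \<in> U" "None \<in> V" "U \<times> V \<subseteq> topspace ?Y - G"
      unfolding openin_prod_topology_alt by meson
    obtain W where W: "open W" "U = S \<inter> W" using UV(1) by (auto simp: openin_open)
    then obtain B where B: "B \<in> \<D>" "t \<in> B" "B \<subseteq> W"
      using UV(3) \<D>(2) topological_basisE by (metis IntD2)
    have "Some ` e B \<subseteq> insert None (Some ` D) - V"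
    proof clarify
      fix d' assume "d' \<in> e B"
      then obtain t' where t': "d' \<in> D" "t' \<in> B" "(t', Some d') \<in> G" by (auto simp: e_def)
      then have "t' \<in> U" using closedin_subset[OF assms] B W by auto
      then have "Some d' \<notin> V" using UV(5) t' by auto
      then show "Some d' \<in> insert None (Some ` D) - V" using t' by simp
    qed
    moreover have "finite (insert None (Some ` D) - V)"
      using UV openin_discrete_compactification by blast
    ultimately have "finite (e B)" by (metis finite_imageD finite_subset inj_Some)
    moreover have "d \<in> e B" using d B by (auto simp: e_def)
    ultimately show ?thesis using B by blast
  qed
  then have "{d \<in> D. \<exists>t. (t, Some d) \<in> G \<and> (t, None) \<notin> G} \<subseteq> \<Union>(e ` {B \<in> \<D>. finite (e B)})"
    by blast
  moreover have "countable (\<Union>(e ` {B \<in> \<D>. finite (e B)}))"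
    using \<D>(1) by (intro countable_UN) (auto intro: countable_finite)
  ultimately show ?thesis by (rule countable_subset)
qed

definition tree_space :: "'a set \<Rightarrow> ('a \<Rightarrow> real) \<Rightarrow> (real \<times> 'a option) set" where
  "tree_space D h = {0..1} \<times> {None} \<union> (\<Union>d\<in>D. tree_set (h d) \<times> {Some d})"

lemma closedin_tree_space:
  "closedin (prod_topology (top_of_set {0..1}) (discrete_compactification D)) (tree_space D h)"
proof -
  let ?Y = "prod_topology (top_of_set {0..1}) (discrete_compactification D)"
  have "openin ?Y (({0..1} - tree_set (h d)) \<times> {Some d})" if "d \<in> D" for d
  proof -
    have "openin (top_of_set {0..1}) ({0..1} - tree_set (h d))"
      by (metis Diff_eq closed_tree_set open_Compl openin_open_Int)
    then show ?thesis
      using that by (simp add: openin_prod_Times_iff openin_discrete_compactification)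
  qed
  then have "openin ?Y (\<Union>d\<in>D. ({0..1} - tree_set (h d)) \<times> {Some d})" by auto
  moreover have "topspace ?Y - tree_space D h = (\<Union>d\<in>D. ({0..1} - tree_set (h d)) \<times> {Some d})"
    by (auto simp: tree_space_def)
  moreover have "tree_space D h \<subseteq> topspace ?Y"
    using tree_set_subset by (fastforce simp: tree_space_def)
  ultimately show ?thesis by (simp add: closedin_def)
qed

lemma not_supercompact_tree_space:
  fixes D :: "'a set"
  assumes "\<not> meager (h ` D)"
  defines "X \<equiv> subtopology (prod_topology (top_of_set {0..1}) (discrete_compactification D)) (tree_space D h)"
  shows "\<not> supercompact_space X"
proof
  assume "supercompact_space X"
  define Y where "Y = prod_topology (top_of_set {0..1::real}) (discrete_compactification D)"
  define Z where "Z = tree_space D h"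
  define F where "F d = tree_set (h d)" for d
  have Z: "closedin Y Z" unfolding Y_def Z_def by (rule closedin_tree_space)
  have X: "X = subtopology Y Z" by (simp add: X_def Y_def Z_def)
  have topX: "topspace X = Z" using closedin_subset[OF Z] by (auto simp: X)
  have "compact_space Y"
    unfolding Y_def compact_space_prod_topology
    by (simp add: compact_space_discrete_compactification compact_space_subtopology)
  then have "compact_space X"
    using Z by (simp add: X closedin_compact_space compact_space_subtopology)
  from \<open>supercompact_space X\<close> this obtain \<A> where closed\<A>: "\<And>A. A \<in> \<A> \<Longrightarrow> closedin X A"
    and binary: "\<And>A B C. A \<in> \<A> \<Longrightarrow> B \<in> \<A> \<Longrightarrow> C \<in> \<A> \<Longrightarrow>
      A \<inter> B \<noteq> {} \<Longrightarrow> A \<inter> C \<noteq> {} \<Longrightarrow> B \<inter> C \<noteq> {} \<Longrightarrow> A \<inter> B \<inter> C \<noteq> {}"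
    and between: "\<And>K U. closedin X K \<Longrightarrow> openin X U \<Longrightarrow> K \<subseteq> U \<Longrightarrow>
      \<exists>\<G>. finite \<G> \<and> \<G> \<subseteq> \<A> \<and> K \<subseteq> \<Union>\<G> \<and> \<Union>\<G> \<subseteq> U"
    by (rule supercompact_spaceE) blast
  have closedY: "closedin Y A" if "A \<in> \<A>" for A
    using closed\<A>[OF that] Z unfolding X by (rule closedin_trans_full)
  have sub_Z: "A \<subseteq> Z" if "A \<in> \<A>" for A using closed\<A>[OF that] closedin_subset topX by blast
  have closed_section: "closed {t. (t, z) \<in> A}" if "A \<in> \<A>" for A z
    using closedY[OF that] unfolding Y_def by (rule closedin_prod_interval_section)

  \<comment> \<open>The fibre over \<open>d\<close> is clopen, hence a finite union of members of \<open>\<A>\<close>, one of which has interior in it.\<close>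
  have dominated: "\<exists>n p A. p div 2 ^ n = 1 \<and> alive (h d) p \<and> A \<in> \<A> \<and> A \<subseteq> F d \<times> {Some d} \<and>
      (F d \<inter> cell n p) \<times> {Some d} \<subseteq> A" if "d \<in> D" for d
  proof -
    have Some_D: "openin (discrete_compactification D) {Some d}" "closedin (discrete_compactification D) {Some d}"
      using that by (auto simp: closedin_def openin_discrete_compactification double_diff)
    have "F d \<times> {Some d} = ({0..1} \<times> {Some d}) \<inter> Z"
      using that tree_set_subset[of "h d"] by (auto simp: Z_def tree_space_def F_def)
    moreover have "openin Y ({0..1} \<times> {Some d})"
      using Some_D by (simp add: Y_def openin_prod_Times_iff)
    ultimately have op: "openin X (F d \<times> {Some d})" unfolding X openin_subtopology by blast
    have "closedin Y ({0..1} \<times> {Some d})"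
      using Some_D by (simp add: Y_def closedin_prod_Times_iff)
    then have cl: "closedin X (F d \<times> {Some d})"
      using \<open>F d \<times> {Some d} = _\<close> unfolding X closedin_subtopology by blast
    from between[OF cl op order_refl] obtain \<G>
      where G: "finite \<G>" "\<G> \<subseteq> \<A>" "\<Union>\<G> = F d \<times> {Some d}"
      by (elim exE conjE) (metis subset_antisym)
    let ?s = "\<lambda>A. {t. (t, Some d) \<in> A}"
    have "F d \<subseteq> \<Union>(?s ` \<G>)"
    proof
      fix t assume "t \<in> F d"
      then have "(t, Some d) \<in> \<Union>\<G>" using G by simp
      then show "t \<in> \<Union>(?s ` \<G>)" by blast
    qed
    moreover have "closed B" if "B \<in> ?s ` \<G>" for B using that G closed_section by auto
    moreover have "F d \<noteq> {}" unfolding F_def by (rule tree_set_nonempty)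
    ultimately obtain A V where AV: "A \<in> \<G>" "open V" "V \<inter> F d \<noteq> {}" "V \<inter> F d \<subseteq> ?s A"
      using finite_closed_cover_contains_relatively_open[of "?s ` \<G>" "F d"] G(1) by auto
    obtain n p where np: "p div 2 ^ n = 1" "alive (h d) p" "cell n p \<subseteq> V"
      using tree_set_cell_in_open[of V "h d"] AV(2,3) unfolding F_def by metis
    have "A \<in> \<A>" "A \<subseteq> F d \<times> {Some d}" using AV(1) G by auto
    moreover have "(F d \<inter> cell n p) \<times> {Some d} \<subseteq> A" using AV(4) np(3) by auto
    ultimately show ?thesis using np by blast
  qed

  \<comment> \<open>Finitely many members of \<open>\<A>\<close> cover a tube around
    \<open>b\<close> and stay within \<open>\<eta>\<close> of \<open>b\<close>. Outside countably
    many fibres their points project into their traces at infinity, and close to \<open>b\<close>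
    the tube is covered there by members containing \<open>(b, None)\<close>.\<close>
  have local: "\<exists>\<G> E \<rho>. finite \<G> \<and> \<G> \<subseteq> \<A> \<and> countable E \<and> 0 < \<rho> \<and> \<rho> \<le> \<eta> \<and>
      (\<forall>d\<in>D-E. \<forall>t\<in>F d. \<bar>t - b\<bar> < \<rho> \<longrightarrow> (\<exists>G\<in>\<G>. (t, Some d) \<in> G \<and> (b, None) \<in> G)) \<and>
      (\<forall>G\<in>\<G>. \<forall>d\<in>D-E. \<forall>t. (t, Some d) \<in> G \<longrightarrow> (t, None) \<in> G) \<and>
      (\<forall>G\<in>\<G>. \<forall>t. (t, None) \<in> G \<longrightarrow> \<bar>t - b\<bar> < \<eta>)" if "\<eta> > 0" for b \<eta> :: real
  proof -
    have "continuous_map Y (top_of_set {0..1}) fst" unfolding Y_def by (rule continuous_map_fst)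
    then have "continuous_map X euclideanreal fst"
      unfolding X by (intro continuous_map_from_subtopology) (rule continuous_map_into_fulltopology)
    then have cont: "continuous_map X euclideanreal (\<lambda>z. \<bar>fst z - b\<bar>)"
      by (intro continuous_intros) auto
    let ?K = "{z \<in> topspace X. \<bar>fst z - b\<bar> \<in> {..\<eta>/2}}"
    let ?O = "{z \<in> topspace X. \<bar>fst z - b\<bar> \<in> {..<\<eta>}}"
    have "closedin X ?K" by (rule closedin_continuous_map_preimage[OF cont]) simp
    moreover have "openin X ?O" by (rule openin_continuous_map_preimage[OF cont]) simp
    moreover have "?K \<subseteq> ?O" using that by auto
    ultimately have "\<exists>\<G>. finite \<G> \<and> \<G> \<subseteq> \<A> \<and> ?K \<subseteq> \<Union>\<G> \<and> \<Union>\<G> \<subseteq> ?O"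
      by (rule between)
    then obtain \<G> where G: "finite \<G>" "\<G> \<subseteq> \<A>" "?K \<subseteq> \<Union>\<G>" "\<Union>\<G> \<subseteq> ?O"
      by (elim exE conjE) rule
    \<comment> \<open>The traces at infinity that omit \<open>b\<close> have a closed union, so a
      ball around \<open>b\<close> avoids them. A member with a point of a non-exceptional fibre
      over that ball must then contain \<open>(b, None)\<close>.\<close>
    define C where "C = (\<Union>G\<in>{G \<in> \<G>. (b, None) \<notin> G}. {t. (t, None) \<in> G})"
    have "closed C" unfolding C_def using G closed_section by (intro closed_UN) auto
    moreover have "b \<in> - C" by (auto simp: C_def)
    ultimately obtain r where r: "r > 0" "ball b r \<subseteq> - C" by (metis open_Compl openE)
    define E where "E = (\<Union>G\<in>\<G>. {d \<in> D. \<exists>t. (t, Some d) \<in> G \<and> (t, None) \<notin> G})"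
    have "countable E"
      unfolding E_def using G closedY
      by (intro countable_UN countable_sections_not_below_infinity[where S = "{0..1}"] countable_finite)
        (auto simp: Y_def)
    have below: "(t, None) \<in> G" if "G \<in> \<G>" "d \<in> D - E" "(t, Some d) \<in> G" for G d t
      using that by (auto simp: E_def)
    have "\<exists>G\<in>\<G>. (t, Some d) \<in> G \<and> (b, None) \<in> G"
      if t: "d \<in> D - E" "t \<in> F d" "\<bar>t - b\<bar> < min r (\<eta>/2)" for d t
    proof -
      have "(t, Some d) \<in> Z" using t by (auto simp: Z_def tree_space_def F_def)
      then have "(t, Some d) \<in> ?K" using t topX by simp
      then obtain G' where G': "G' \<in> \<G>" "(t, Some d) \<in> G'" using G by blast
      have "t \<in> ball b r" using t by (simp add: dist_real_def abs_minus_commute)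
      then have "t \<notin> C" using r by blast
      then have "(b, None) \<in> G'" using below[OF G'(1) t(1) G'(2)] G'(1) by (auto simp: C_def)
      then show ?thesis using G' by blast
    qed
    moreover have "\<bar>t - b\<bar> < \<eta>" if "G \<in> \<G>" "(t, None) \<in> G" for G t
      using that G(4) by auto
    ultimately show ?thesis
      using G \<open>countable E\<close> below r \<open>\<eta> > 0\<close>
      by (intro exI[of _ \<G>] exI[of _ E] exI[of _ "min r (\<eta>/2)"]) auto
  qed

  \<comment> \<open>The class \<open>N n p\<close> gathers the \<open>d\<close> for which the same
    cell works in \<open>dominated\<close>. There are countably many classes, so the image of one of
    them under \<open>h\<close> is non-meager.\<close>
  define N where "N n p = {d \<in> D. p div 2 ^ n = 1 \<and> alive (h d) p \<and>
    (\<exists>A\<in>\<A>. A \<subseteq> F d \<times> {Some d} \<and> (F d \<inter> cell n p) \<times> {Some d} \<subseteq> A)}" for n p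
  have D_sub: "d \<in> (\<Union>z. N (fst z) (snd z))" if "d \<in> D" for d
  proof -
    have "\<exists>n p. d \<in> N n p" unfolding N_def using dominated[OF that] that by blast
    then obtain n p where "d \<in> N n p" by blast
    then show ?thesis by (intro UN_I[of "(n, p)"]) simp_all
  qed
  have "N n p \<subseteq> D" for n p unfolding N_def by (rule Collect_restrict)
  with D_sub have "D = (\<Union>z. N (fst z) (snd z))" by blast
  then have hD: "h ` D = (\<Union>z. h ` N (fst z) (snd z))" by (metis image_UN)
  have "\<exists>n p. \<not> meager (h ` N n p)"
  proof (rule ccontr)
    assume "\<not> ?thesis"
    then have "meager (\<Union>z. h ` N (fst z) (snd z))" by (intro meager_UN) simp_all
    then show False using assms(1) hD by simp
  qed
  then obtain n p where np: "\<not> meager (h ` N n p)" by blast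
  obtain I where I: "open I" "I \<noteq> {}"
    "\<And>J. open J \<Longrightarrow> J \<noteq> {} \<Longrightarrow> J \<subseteq> I \<Longrightarrow> uncountable (h ` N n p \<inter> J)"
    using non_meager_locally_uncountable[OF np] by metis
  \<comment> \<open>Local uncountability of the codes leaves room to avoid countably many
    exceptional fibres while prescribing an open condition on \<open>h d\<close>.\<close>
  have pick: "\<exists>d\<in>N n p - E. h d \<in> J" if "open J" "J \<noteq> {}" "J \<subseteq> I" "countable E" for J E
  proof (rule ccontr)
    assume "\<not> ?thesis"
    then have "h ` N n p \<inter> J \<subseteq> h ` E" by auto
    then have "countable (h ` N n p \<inter> J)" using that(4) by (rule countable_subset[OF _ countable_image])
    with I(3)[OF that(1-3)] show False by contradiction
  qed
  have "p div 2 ^ n = 1" using pick[OF I(1,2), of "{}"] by (auto simp: N_def)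
  have dense: "\<exists>x\<in>J. alive x p" if "open J" "J \<noteq> {}" "J \<subseteq> I" for J
    using pick[OF that, of "{}"] by (auto simp: N_def)
  obtain a b where ab: "a < b" "{a<..<b} \<subseteq> cell n p"
    and approx: "\<And>T \<delta>. finite T \<Longrightarrow> T \<noteq> {} \<Longrightarrow> T \<subseteq> {a<..<b} \<Longrightarrow> \<delta> > 0 \<Longrightarrow>
      \<exists>J. open J \<and> J \<noteq> {} \<and> J \<subseteq> I \<and> (\<forall>x\<in>J. tree_set x \<inter> {a<..<b} \<subseteq> (\<Union>t\<in>T. ball t \<delta>) \<and>
        (\<forall>t\<in>T. tree_set x \<inter> ball t \<delta> \<noteq> {}))"
    by (rule tree_set_approximates[OF I(1,2) _ \<open>p div 2 ^ n = 1\<close>], rule dense) (assumption+, rule that)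

  \<comment> \<open>\<open>u\<close> is a fibre point just left of \<open>c\<close>; it selects \<open>G\<close> among the coarse sets. The trace of \<open>G\<close> at infinity
    ends at \<open>s\<close>, and \<open>v\<close> is a fibre point just right of \<open>s\<close>; it selects \<open>H'\<close> among the fine sets at \<open>s\<close>.
    \<open>G\<close> and \<open>H'\<close> meet in \<open>(s, \<infinity>)\<close>, but not in the fibre over \<open>d\<close>. Since \<open>G\<close> depends on \<open>d\<close>, the set \<open>T\<close>
    contains a point to the right of every candidate for \<open>s\<close>.\<close>
  define c where "c = (a + b) / 2"
  define \<epsilon> where "\<epsilon> = (b - a) / 4"
  have "\<epsilon> > 0" and ab_eq: "a = c - 2 * \<epsilon>" "b = c + 2 * \<epsilon>" using ab(1) by (auto simp: c_def \<epsilon>_def field_simps)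
  obtain \<G> E0 \<rho> where G: "finite \<G>" "\<G> \<subseteq> \<A>" "countable E0" "0 < \<rho>" "\<rho> \<le> \<epsilon>"
    and G_cover: "\<And>d t. d \<in> D - E0 \<Longrightarrow> t \<in> F d \<Longrightarrow> \<bar>t - c\<bar> < \<rho> \<Longrightarrow> \<exists>G\<in>\<G>. (t, Some d) \<in> G \<and> (c, None) \<in> G"
    and G_below: "\<And>G d t. G \<in> \<G> \<Longrightarrow> d \<in> D - E0 \<Longrightarrow> (t, Some d) \<in> G \<Longrightarrow> (t, None) \<in> G"
    and G_small: "\<And>G t. G \<in> \<G> \<Longrightarrow> (t, None) \<in> G \<Longrightarrow> \<bar>t - c\<bar> < \<epsilon>"
    using local[OF \<open>\<epsilon> > 0\<close>, of c] by metis
  \<comment> \<open>The right end of the trace of \<open>G\<close> at infinity. For the relevant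
    \<open>G\<close> the trace is nonempty, closed and bounded, so the end is attained.\<close>
  define \<beta> where "\<beta> G = Sup {t. (t, None) \<in> G}" for G :: "(real \<times> 'a option) set"
  have \<beta>: "(\<beta> G, None) \<in> G" "\<And>t. (t, None) \<in> G \<Longrightarrow> t \<le> \<beta> G" if "G \<in> \<G>" "(c, None) \<in> G" for G
  proof -
    have bdd: "bdd_above {t. (t, None) \<in> G}"
    proof (rule bdd_aboveI)
      show "t \<le> c + \<epsilon>" if "t \<in> {t. (t, None) \<in> G}" for t
        using that G_small[OF \<open>G \<in> \<G>\<close>, of t] by auto
    qed
    have "\<beta> G \<in> {t. (t, None) \<in> G}" unfolding \<beta>_def
      using closed_section[of G None] G(2) that bdd by (intro closed_contains_Sup) auto
    then show "(\<beta> G, None) \<in> G" by simp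
    show "t \<le> \<beta> G" if "(t, None) \<in> G" for t
      unfolding \<beta>_def using that bdd by (intro cSup_upper) auto
  qed
  define Bs where "Bs = \<beta> ` {G \<in> \<G>. (c, None) \<in> G}"
  have "finite Bs" using G by (simp add: Bs_def)
  have Bs: "c \<le> s \<and> s < c + \<epsilon>" if "s \<in> Bs" for s
  proof -
    from that obtain G where G: "G \<in> \<G>" "(c, None) \<in> G" "s = \<beta> G" by (auto simp: Bs_def)
    then show ?thesis using \<beta>[of G] G_small[of G "\<beta> G"] by fastforce
  qed
  \<comment> \<open>At most half the gap between distinct candidates for \<open>s\<close>, to tell
    them apart; the bound \<open>\<rho> / 4\<close> keeps points near a candidate away from
    \<open>c - \<rho> / 2\<close>.\<close>
  define \<eta> where "\<eta> = Min (insert (\<rho> / 4) ((\<lambda>(s, s'). \<bar>s - s'\<bar> / 2) ` {(s, s') \<in> Bs \<times> Bs. s \<noteq> s'}))"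
  have fin: "finite {(s, s') \<in> Bs \<times> Bs. s \<noteq> s'}"
    by (rule finite_subset[of _ "Bs \<times> Bs"]) (use \<open>finite Bs\<close> in auto)
  have "0 < \<eta>" unfolding \<eta>_def using fin G(4) by (subst Min_gr_iff) auto
  moreover have "\<eta> \<le> \<rho> / 4" unfolding \<eta>_def using fin by (intro Min_le) auto
  ultimately have \<eta>: "0 < \<eta>" "\<eta> \<le> \<rho> / 4" by simp_all
  have sep: "2 * \<eta> \<le> \<bar>s - s'\<bar>" if "s \<in> Bs" "s' \<in> Bs" "s \<noteq> s'" for s s'
  proof -
    have "\<eta> \<le> \<bar>s - s'\<bar> / 2" unfolding \<eta>_def using fin that by (intro Min_le) auto
    then show ?thesis by simp
  qed
  obtain \<H> E \<sigma> where H: "\<And>s. finite (\<H> s)" "\<And>s. \<H> s \<subseteq> \<A>" "\<And>s. countable (E s)" "\<And>s. 0 < \<sigma> s"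
    and H_cover: "\<And>s d t. d \<in> D - E s \<Longrightarrow> t \<in> F d \<Longrightarrow> \<bar>t - s\<bar> < \<sigma> s \<Longrightarrow>
      \<exists>G\<in>\<H> s. (t, Some d) \<in> G \<and> (s, None) \<in> G"
    and H_below: "\<And>s G d t. G \<in> \<H> s \<Longrightarrow> d \<in> D - E s \<Longrightarrow> (t, Some d) \<in> G \<Longrightarrow> (t, None) \<in> G"
    and H_small: "\<And>s G t. G \<in> \<H> s \<Longrightarrow> (t, None) \<in> G \<Longrightarrow> \<bar>t - s\<bar> < \<eta>"
    using local[OF \<open>\<eta> > 0\<close>] by metis
  \<comment> \<open>The bound \<open>\<sigma> s / 2\<close> puts fibre points within
    \<open>r / 2\<close> of \<open>s + r\<close> in the range of \<open>H_cover\<close>; the bound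
    \<open>\<eta> / 2\<close> makes the shift by \<open>r\<close> harmless for the separation of
    candidates.\<close>
  define r where "r = Min (insert (\<eta> / 2) ((\<lambda>s. \<sigma> s / 2) ` Bs))"
  have "0 < r" unfolding r_def using \<open>finite Bs\<close> \<eta> H(4) by (subst Min_gr_iff) auto
  moreover have "r \<le> \<eta> / 2" unfolding r_def using \<open>finite Bs\<close> by (intro Min_le) auto
  ultimately have r: "0 < r" "r \<le> \<eta> / 2" by simp_all
  have r_\<sigma>: "2 * r \<le> \<sigma> s" if "s \<in> Bs" for s
  proof -
    have "r \<le> \<sigma> s / 2" unfolding r_def using \<open>finite Bs\<close> that by (intro Min_le) auto
    then show ?thesis by simp
  qed
  define T where "T = insert (c - \<rho> / 2) ((\<lambda>s. s + r) ` Bs)"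
  have T: "finite T" "T \<noteq> {}" using \<open>finite Bs\<close> by (simp_all add: T_def)
  have "T \<subseteq> {a<..<b}"
    using Bs r \<eta> G(4,5) \<open>\<epsilon> > 0\<close> unfolding T_def ab_eq by fastforce
  with T r(1) obtain J where J: "open J" "J \<noteq> {}" "J \<subseteq> I"
    "\<And>x. x \<in> J \<Longrightarrow> tree_set x \<inter> {a<..<b} \<subseteq> (\<Union>t\<in>T. ball t (r/2)) \<and> (\<forall>t\<in>T. tree_set x \<inter> ball t (r/2) \<noteq> {})"
    using approx[of T "r/2"] by (metis half_gt_zero)
  have "countable (E0 \<union> (\<Union>s\<in>Bs. E s))"
    using G(3) H(3) \<open>finite Bs\<close> by (auto intro: countable_finite)
  then obtain d where d: "d \<in> N n p" "d \<notin> E0" "\<And>s. s \<in> Bs \<Longrightarrow> d \<notin> E s" "h d \<in> J"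
    using pick[OF J(1-3)] by blast
  then obtain A where A: "d \<in> D" "A \<in> \<A>" "A \<subseteq> F d \<times> {Some d}" "(F d \<inter> cell n p) \<times> {Some d} \<subseteq> A"
    by (auto simp: N_def)
  have in_A: "(t, Some d) \<in> A" if "t \<in> F d" "a < t" "t < b" for t
    using that A(4) ab(2) by auto
  have F_near: "\<exists>s\<in>T. \<bar>t - s\<bar> < r / 2" if "t \<in> F d" "a < t" "t < b" for t
  proof -
    have "t \<in> F d \<inter> {a<..<b}" using that by simp
    then have "t \<in> (\<Union>s\<in>T. ball s (r/2))" using J(4)[OF d(4)] unfolding F_def by blast
    then show ?thesis by (auto simp: dist_real_def abs_minus_commute)
  qed
  have near_F: "\<exists>t\<in>F d. \<bar>t - s\<bar> < r / 2" if "s \<in> T" for s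
  proof -
    have "F d \<inter> ball s (r/2) \<noteq> {}" using J(4)[OF d(4)] that unfolding F_def by blast
    then show ?thesis by (auto simp: dist_real_def abs_minus_commute)
  qed
  obtain u where u: "u \<in> F d" "\<bar>u - (c - \<rho> / 2)\<bar> < r / 2"
    using near_F[of "c - \<rho> / 2"] by (auto simp: T_def)
  then have u_c: "\<bar>u - c\<bar> < \<rho>" using r \<eta> by linarith
  then obtain G where G': "G \<in> \<G>" "(u, Some d) \<in> G" "(c, None) \<in> G"
    using G_cover[of d u] d A u by auto
  define s where "s = \<beta> G"
  have s: "s \<in> Bs" "(s, None) \<in> G" "\<And>t. (t, None) \<in> G \<Longrightarrow> t \<le> s"
    using G' \<beta>[of G] by (auto simp: s_def Bs_def)
  obtain v where v: "v \<in> F d" "\<bar>v - (s + r)\<bar> < r / 2"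
    using near_F[of "s + r"] s(1) by (auto simp: T_def)
  then have v_s: "\<bar>v - s\<bar> < 2 * r" using r by linarith
  then obtain H' where H': "H' \<in> \<H> s" "(v, Some d) \<in> H'" "(s, None) \<in> H'"
    using H_cover[of d s v] r_\<sigma>[OF s(1)] d(3)[OF s(1)] A v by auto
  have "(u, Some d) \<in> A" using in_A u u_c G(5) \<open>\<epsilon> > 0\<close> unfolding ab_eq by auto
  moreover have "(v, Some d) \<in> A"
    using in_A v v_s r \<eta> G(5) Bs[OF s(1)] \<open>\<epsilon> > 0\<close> unfolding ab_eq by auto
  \<comment> \<open>\<open>A\<close> meets \<open>G\<close> over \<open>u\<close> and
    \<open>H'\<close> over \<open>v\<close>, while \<open>G\<close> and \<open>H'\<close> meet at
    infinity. Any common point lies in the fibre over \<open>d\<close> because \<open>A\<close>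
    does.\<close>
  ultimately have "A \<inter> G \<inter> H' \<noteq> {}"
    using binary[of A G H'] A(2) G' H' s(2) G(2) H(2)[of s] by blast
  then obtain t where t: "t \<in> F d" "(t, Some d) \<in> G" "(t, Some d) \<in> H'"
    using A(3) by auto
  have "t \<le> s" using s(3) G_below[OF G'(1) _ t(2)] A(1) d(2) by blast
  have t_s: "\<bar>t - s\<bar> < \<eta>" using H_small[OF H'(1)] H_below[OF H'(1) _ t(3)] A(1) d(3)[OF s(1)] by blast
  have "a < t" "t < b" using t_s \<eta> G(5) Bs[OF s(1)] \<open>\<epsilon> > 0\<close> unfolding ab_eq by auto
  then obtain w where w: "w \<in> T" "\<bar>t - w\<bar> < r / 2" using F_near[OF t(1)] by blast
  \<comment> \<open>The point \<open>t\<close> must be within \<open>r / 2\<close> of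
    \<open>T\<close>, but \<open>t \<le> s\<close> and its distance from \<open>s\<close> is below
    \<open>\<eta>\<close>. So it is too far right for \<open>c - \<rho> / 2\<close>, too far left
    for \<open>s + r\<close>, and the gaps between candidates exclude every other
    \<open>s' + r\<close>.\<close>
  then consider "w = c - \<rho> / 2" | "w = s + r" | s' where "w = s' + r" "s' \<in> Bs" "s' \<noteq> s"
    unfolding T_def by auto
  then show False
  proof cases
    case 1
    then show False using w t_s r \<eta> Bs[OF s(1)] G(4) by linarith
  next
    case 2
    then show False using w \<open>t \<le> s\<close> r by linarith
  next
    case 3
    then show False using w t_s r sep[OF 3(2) s(1) 3(3)] by linarith
  qed
qed

theorem corollary5p5:
  fixes D :: "'a set"
  assumes "|D| =o non_meager_card"
  shows "hereditarily_supercompact_space (top_of_set {0..1::real}) \<and>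
         hereditarily_supercompact_space (discrete_compactification D) \<and>
         \<not> hereditarily_supercompact_space
             (prod_topology (top_of_set {0..1::real}) (discrete_compactification D))"
proof (intro conjI)
  obtain N :: "real set" where N: "\<not> meager N" "|N| =o non_meager_card"
    using non_meager_card_attained by blast
  then have "|D| =o |N|" using assms ordIso_symmetric ordIso_transitive by blast
  \<comment> \<open>A bijection onto a non-meager set of least cardinality serves as the coding of
    fibres.\<close>
  then obtain h where "bij_betw h D N" using card_of_ordIso by blast
  then have "\<not> meager (h ` D)" using N(1) by (simp add: bij_betw_def)
  then show "\<not> hereditarily_supercompact_space
      (prod_topology (top_of_set {0..1::real}) (discrete_compactification D))"
    unfolding hereditarily_supercompact_space_def
    using not_supercompact_tree_space closedin_tree_space by blast
qed (rule hereditarily_supercompact_space_interval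
    hereditarily_supercompact_space_discrete_compactification)+

end
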